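(* Let $1\le k\le n$. The intersection ring of the $\mathbb{Z}[D_n]$-intersection pair $(\bigwedge^k(M[D_n]),D_t)$ is given by $$\mathcal{A}^*\Big(\bigwedge^k(M[D_n]),D_t\Big)=\frac{\mathbb{Z}[D_n][D_1,\ldots,D_k]}{(D_{n-k+1},\ldots,D_{n-1})}.$$
   Context: $M=\bigoplus_{i\ge1}\mathbb{Z}\epsilon^i$ is the free $\mathbb{Z}$-module with basis $(\epsilon^1,\epsilon^2,\ldots)$, with endomorphisms $D_j\epsilon^i=\epsilon^{i+j}$ ($j\ge0$). $M[D_n]$ denotes $M$ regarded as a module over the polynomial ring $\mathbb{Z}[D_n]$, the variable acting as the shift $\epsilon^i\mapsto\epsilon^{i+n}$; it is free of rank $n$ with basis $\epsilon^1,\ldots,\epsilon^n$, and the $D_j$ are $\mathbb{Z}[D_n]$-linear. Exterior powers of $M[D_n]$ are taken over $\mathbb{Z}[D_n]$. $D_t=\sum_{j\ge0}D_jt^j$ is extended to $\bigwedge M[D_n]\to(\bigwedge M[D_n])[[t]]$ by requiring it to be a $\mathbb{Z}[D_n]$-algebra homomorphism, $D_t(\alpha\wedge\beta)=D_t\alpha\wedge D_t\beta$; its coefficients $D_j$ act on $\bigwedge^kM[D_n]$ and commute pairwise. For a base ring $A$, an $A$-intersection pair is a free $A$-module $N$ with a sequence $(D_0,D_1,\ldots)$ of pairwise commuting $A$-endomorphisms such that for some $m_0\in N$ the map $A[T_1,T_2,\ldots]\to N$, $P\mapsto P(D_1,D_2,\ldots)m_0$ is surjective; its intersection ring $\mathcal{A}^*(N,D_t)$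 is the commutative $A$-subalgebra $A[D]\subseteq\mathrm{End}_A(N)$ generated by the $D_i$ ($i\ge 1$). $(\bigwedge^k(M[D_n]),D_t)$ is a $\mathbb{Z}[D_n]$-intersection pair with $m_0=\epsilon^1\wedge\cdots\wedge\epsilon^k$. In the presentation, $D_1,\ldots,D_k$ are indeterminates (with $D_i$ corresponding to the operator $D_i$), and for $h>k$ the symbol $D_h$ stands for the polynomial in $D_1,\ldots,D_k$ defined recursively by $D_h=-\sum_{j=1}^k a_jD_{h-j}$, where $1+\sum_{j\ge1}a_jt^j$ is the formal inverse of $1+\sum_{i\ge1}D_it^i$ (so that $a_1,\dots,a_k$ are polynomials in $D_1,\ldots,D_k$). The scalar variable $D_n$ of the base ring is identified with this polynomial $D_n$; thus, naming the base variable $q$, the right-hand side is the $\mathbb{Z}[q]$-algebra $\mathbb{Z}[q][D_1,\ldots,D_k]/(D_{n-k+1},\ldots,D_{n-1},D_n-q)$. Conventions: $D_0=1$, $D_j=0$ for $j<0$. *)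

theory Defs
  imports
    "HOL-Algebra.Algebraic_Closure_Type"
    "HOL-Algebra.Generated_Rings"
    "HOL-Computational_Algebra.Formal_Power_Series"
    "HOL-Library.Poly_Mapping"
begin

section \<open>Exterior algebra of a module over a commutative ring\<close>

text \<open>
  The module has underlying type \<^typ>\<open>'m\<close>, base ring \<^typ>\<open>'r\<close> and scalar action \<open>s\<close>.  The finitely
  supported functions on words over \<^typ>\<open>'m\<close>, with convolution product, form the free associative
  \<^typ>\<open>'r\<close>-algebra on the set \<^typ>\<open>'m\<close>; dividing by linearity of the generators gives the tensor
  algebra, and dividing also by the squares of the generators gives the exterior algebra.
\<close>

datatype 'm fword = Word (letters: "'m list")

instantiation fword :: (type) monoid_add
begin

definition zero_fword :: "'a fword" where "0 = Word []"

definition plus_fword :: "'a fword \<Rightarrow> 'a fword \<Rightarrow> 'a fword"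
  where "u + v = Word (letters u @ letters v)"

instance by standard (simp_all add: zero_fword_def plus_fword_def)

end

type_synonym ('m, 'r) free_alg = "'m fword \<Rightarrow>\<^sub>0 'r"

definition gen :: "'m \<Rightarrow> ('m, 'r::comm_ring_1) free_alg"
  where "gen x = Poly_Mapping.single (Word [x]) 1"

definition scal :: "'r \<Rightarrow> ('m, 'r::comm_ring_1) free_alg"
  where "scal c = Poly_Mapping.single 0 c"

definition ext_relations ::
  "('r::comm_ring_1 \<Rightarrow> 'm::ab_group_add \<Rightarrow> 'm) \<Rightarrow> ('m, 'r) free_alg set"
  where "ext_relations s =
    {gen (x + y) - (gen x + gen y) |x y. True} \<union>
    {gen (s c x) - scal c * gen x |c x. True} \<union>
    {gen x * gen x |x. True}"

definition ext_ideal ::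
  "('r::comm_ring_1 \<Rightarrow> 'm::ab_group_add \<Rightarrow> 'm) \<Rightarrow> ('m, 'r) free_alg set"
  where "ext_ideal s = Idl\<^bsub>ring_of_type_algebra\<^esub> (ext_relations s)"

definition ext_class ::
  "('r::comm_ring_1 \<Rightarrow> 'm::ab_group_add \<Rightarrow> 'm) \<Rightarrow> ('m, 'r) free_alg \<Rightarrow> ('m, 'r) free_alg set"
  where "ext_class s p = ext_ideal s +>\<^bsub>ring_of_type_algebra\<^esub> p"

definition exterior_algebra ::
  "('r::comm_ring_1 \<Rightarrow> 'm::ab_group_add \<Rightarrow> 'm) \<Rightarrow> ('m, 'r) free_alg set ring"
  where "exterior_algebra s = ring_of_type_algebra Quot (ext_ideal s)"

text \<open>
  The \<open>k\<close>-th exterior power is the image of the homogeneous elements of degree \<open>k\<close>.  The fields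
  \<open>mult\<close> and \<open>one\<close>, which play no role for a module, are inherited from the exterior algebra.
\<close>

definition exterior_power ::
  "nat \<Rightarrow> ('r::comm_ring_1 \<Rightarrow> 'm::ab_group_add \<Rightarrow> 'm) \<Rightarrow> ('r, ('m, 'r) free_alg set) module"
  where "exterior_power k s =
    \<lparr>carrier = ext_class s ` {p. \<forall>w\<in>Poly_Mapping.keys p. length (letters w) = k},
     monoid.mult = monoid.mult (exterior_algebra s),
     monoid.one = monoid.one (exterior_algebra s),
     ring.zero = ring.zero (exterior_algebra s),
     ring.add = ring.add (exterior_algebra s),
     module.smult = (\<lambda>c a. ext_class s (scal c) \<otimes>\<^bsub>exterior_algebra s\<^esub> a)\<rparr>"


section \<open>Extension of a sequence of endomorphisms to the exterior algebra\<close>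

text \<open>
  \<open>hs_free d\<close> is the algebra homomorphism from the free algebra \<open>F\<close> to \<open>F[[t]]\<close> with
  \<open>x \<mapsto> \<Sum>j. d j x * t^j\<close> on generators.  If all \<open>d j\<close> are linear, it sends \<open>ext_ideal s\<close> to power
  series with coefficients in \<open>ext_ideal s\<close>: for the relations \<open>gen x * gen x\<close> this holds because
  generators anticommute modulo the ideal.  It therefore induces an algebra homomorphism \<open>D\<^sub>t\<close> from
  the exterior algebra to the power series over it; \<open>hs_ext s d j\<close> is its coefficient of \<open>t^j\<close>,
  the union in the definition being that of a single coset.
\<close>

definition hs_free ::
  "(nat \<Rightarrow> 'm \<Rightarrow> 'm) \<Rightarrow> ('m, 'r::comm_ring_1) free_alg \<Rightarrow> ('m, 'r) free_alg fps"
  where "hs_free d p =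
    (\<Sum>w\<in>Poly_Mapping.keys p. fps_const (scal (Poly_Mapping.lookup p w)) *
       prod_list (map (\<lambda>x. Abs_fps (\<lambda>j. gen (d j x))) (letters w)))"

definition hs_ext ::
  "('r::comm_ring_1 \<Rightarrow> 'm::ab_group_add \<Rightarrow> 'm) \<Rightarrow> (nat \<Rightarrow> 'm \<Rightarrow> 'm) \<Rightarrow> nat \<Rightarrow>
     ('m, 'r) free_alg set \<Rightarrow> ('m, 'r) free_alg set"
  where "hs_ext s d j a = (\<Union>p\<in>a. ext_class s (fps_nth (hs_free d p) j))"


section \<open>Intersection rings\<close>

text \<open>Endomorphisms are represented by functions that are \<open>undefined\<close> outside the carrier.\<close>

definition module_End :: "('a, 'c) ring_scheme \<Rightarrow> ('a, 'b, 'd) module_scheme \<Rightarrow> ('b \<Rightarrow> 'b) ring"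
  where "module_End R N =
    \<lparr>carrier = {f \<in> carrier N \<rightarrow>\<^sub>E carrier N.
        (\<forall>x\<in>carrier N. \<forall>y\<in>carrier N. f (x \<oplus>\<^bsub>N\<^esub> y) = f x \<oplus>\<^bsub>N\<^esub> f y) \<and>
        (\<forall>c\<in>carrier R. \<forall>x\<in>carrier N. f (c \<odot>\<^bsub>N\<^esub> x) = c \<odot>\<^bsub>N\<^esub> f x)},
     monoid.mult = compose (carrier N),
     monoid.one = restrict id (carrier N),
     ring.zero = (\<lambda>x\<in>carrier N. \<zero>\<^bsub>N\<^esub>),
     ring.add = (\<lambda>f g. \<lambda>x\<in>carrier N. f x \<oplus>\<^bsub>N\<^esub> g x)\<rparr>"

definition scalar_End :: "('a, 'b, 'd) module_scheme \<Rightarrow> 'a \<Rightarrow> 'b \<Rightarrow> 'b"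
  where "scalar_End N c = (\<lambda>x\<in>carrier N. c \<odot>\<^bsub>N\<^esub> x)"

text \<open>
  The \<open>R\<close>-subalgebra of \<open>End N\<close> generated by \<open>D i\<close>, \<open>i \<ge> 1\<close>, i.e. the subring generated by these and
  by the scalars.  It is commutative if the \<open>D i\<close> commute pairwise, as they do for an intersection
  pair.
\<close>

definition intersection_ring ::
  "('a, 'c) ring_scheme \<Rightarrow> ('a, 'b, 'd) module_scheme \<Rightarrow> (nat \<Rightarrow> 'b \<Rightarrow> 'b) \<Rightarrow> ('b \<Rightarrow> 'b) ring"
  where "intersection_ring R N D = (module_End R N)
    \<lparr>carrier := generate_ring (module_End R N)
       (scalar_End N ` carrier R \<union> {restrict (D i) (carrier N) |i. i \<ge> 1})\<rparr>"


section \<open>The module \<open>M[D\<^sub>n]\<close> and its exterior powers\<close>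

text \<open>
  \<open>M\<close> is the type \<^typ>\<open>nat \<Rightarrow>\<^sub>0 int\<close>, where the basis element \<open>\<epsilon>\<^sup>i\<close>, \<open>i \<ge> 1\<close>, is
  \<open>Poly_Mapping.single (i - 1) 1\<close>.  The ring \<open>\<int>[q]\<close> is \<^typ>\<open>int poly\<close>, with \<open>q = [:0, 1:]\<close> acting on
  \<open>M[D\<^sub>n]\<close> as \<open>D\<^sub>n\<close>.
\<close>

definition shift :: "nat \<Rightarrow> (nat \<Rightarrow>\<^sub>0 int) \<Rightarrow> (nat \<Rightarrow>\<^sub>0 int)"
  where "shift j m =
    (\<Sum>i\<in>Poly_Mapping.keys m. Poly_Mapping.single (i + j) (Poly_Mapping.lookup m i))"

definition act :: "nat \<Rightarrow> int poly \<Rightarrow> (nat \<Rightarrow>\<^sub>0 int) \<Rightarrow> (nat \<Rightarrow>\<^sub>0 int)"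
  where "act n c m = (\<Sum>i\<le>degree c. Poly_Mapping.map ((*) (coeff c i)) ((shift n ^^ i) m))"

abbreviation Zq :: "int poly ring"
  where "Zq \<equiv> ring_of_type_algebra"

abbreviation wedge_M :: "nat \<Rightarrow> nat \<Rightarrow> (int poly, (nat \<Rightarrow>\<^sub>0 int, int poly) free_alg set) module"
  where "wedge_M k n \<equiv> exterior_power k (act n)"

abbreviation D_op :: "nat \<Rightarrow> nat \<Rightarrow>
    (nat \<Rightarrow>\<^sub>0 int, int poly) free_alg set \<Rightarrow> (nat \<Rightarrow>\<^sub>0 int, int poly) free_alg set"
  where "D_op n \<equiv> hs_ext (act n) shift"


section \<open>The presentation\<close>

text \<open>
  Polynomials over \<open>\<int>[q]\<close> in indeterminates indexed by \<^typ>\<open>nat\<close>; the monomials are the finitely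
  supported exponent functions.
\<close>

type_synonym mpoly_q = "(nat \<Rightarrow>\<^sub>0 nat) \<Rightarrow>\<^sub>0 int poly"

definition indet :: "nat \<Rightarrow> mpoly_q"
  where "indet i = Poly_Mapping.single (Poly_Mapping.single i 1) 1"

definition const :: "int poly \<Rightarrow> mpoly_q"
  where "const c = Poly_Mapping.single 0 c"

definition poly_ring :: "nat \<Rightarrow> mpoly_q ring"
  where "poly_ring k = ring_of_type_algebra
    \<lparr>carrier := {p. \<forall>m\<in>Poly_Mapping.keys p. Poly_Mapping.keys m \<subseteq> {1..k}}\<rparr>"

text \<open>
  The inverse is taken of the series in all the indeterminates; its coefficient of \<open>t^j\<close> involves
  only the first \<open>j\<close> of them, so that \<open>D_poly k\<close> below uses only \<open>indet 1, \<dots>, indet k\<close>.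
\<close>

definition inv_coeff :: "nat \<Rightarrow> mpoly_q"
  where "inv_coeff j =
    fps_nth (fps_right_inverse (Abs_fps (\<lambda>i. if i = 0 then 1 else indet i)) 1) j"

function D_poly :: "nat \<Rightarrow> nat \<Rightarrow> mpoly_q"
  where "D_poly k h =
    (if h = 0 then 1
     else if h \<le> k then indet h
     else - (\<Sum>j=1..k. inv_coeff j * D_poly k (h - j)))"
  by auto
termination by (relation "Wellfounded.measure snd") auto

declare D_poly.simps [simp del]

definition pres_ideal :: "nat \<Rightarrow> nat \<Rightarrow> mpoly_q set"
  where "pres_ideal k n =
    Idl\<^bsub>poly_ring k\<^esub> (D_poly k ` {n - k + 1..n - 1} \<union> {D_poly k n - const [:0, 1:]})"

definition pres_ring :: "nat \<Rightarrow> nat \<Rightarrow> mpoly_q set ring"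
  where "pres_ring k n = poly_ring k Quot (pres_ideal k n)"

definition pres_class :: "nat \<Rightarrow> nat \<Rightarrow> mpoly_q \<Rightarrow> mpoly_q set"
  where "pres_class k n p = pres_ideal k n +>\<^bsub>poly_ring k\<^esub> p"

end

theory Submission
  imports Defs "Jordan_Normal_Form.Determinant"
begin

text \<open>
  Write \<open>F\<close> for the free \<open>\<int>[q]\<close>-algebra on the set \<open>M\<close>, \<open>I\<close> for the ideal of exterior
  relations and \<open>J\<close> for the ideal of the presentation. The operator \<open>D\<^sub>j\<close> of the \<open>k\<close>-th
  exterior power is induced by an operator \<open>D_free j\<close> on \<open>F\<close>, and the \<open>D_free j\<close> already
  commute on \<open>F\<close>. Hence a polynomial \<open>p\<close> in \<open>D\<^sub>1, \<dots>, D\<^sub>k\<close> acts on \<open>F\<close> as an operator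
  \<open>poly_op k p\<close>, and the core of the theorem is the statement \<open>poly_op_kernel\<close>: this operator maps
  words of length \<open>k\<close> into \<open>I\<close> exactly if \<open>p \<in> J\<close>.

  The operators \<open>D\<^sub>1, \<dots>, D\<^sub>k\<close> generate the intersection ring because the inverse series of \<open>D\<^sub>t\<close>
  is \<open>\<epsilon>\<^sup>i \<mapsto> \<epsilon>\<^sup>i - \<epsilon>\<^sup>i\<^sup>+\<^sup>1 t\<close> on \<open>M\<close>, so that it is a polynomial in \<open>t\<close> of degree at most \<open>k\<close> on
  words of length \<open>k\<close>. This is the recursion that defines the polynomials \<open>D\<^sub>h\<close> for \<open>h > k\<close>;
  thus these polynomials act as the operators of the same name (\<open>poly_op_D_poly\<close>).

  The relations hold. By Pieri's formula \<open>D\<^sub>h\<close> maps \<open>m\<^sub>0 = \<epsilon>\<^sup>1 \<and> \<dots> \<and> \<epsilon>\<^sup>k\<close> to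
  \<open>\<epsilon>\<^sup>1 \<and> \<dots> \<and> \<epsilon>\<^sup>k\<^sup>-\<^sup>1 \<and> \<epsilon>\<^sup>k\<^sup>+\<^sup>h\<close>. For \<open>n - k < h < n\<close> the last factor is \<open>q\<close> times an earlier one, and
  for \<open>h = n\<close> it is \<open>q \<epsilon>\<^sup>k\<close>; so \<open>D\<^sub>h\<close> and \<open>D\<^sub>n - q\<close> annihilate \<open>m\<^sub>0\<close>. Operators that commute with
  all \<open>D\<^sub>j\<close> and annihilate \<open>m\<^sub>0\<close> are zero, because \<open>m\<^sub>0\<close> generates the exterior power
  (\<open>homogeneous_subset_cyclic_span\<close>).

  There are no other relations. Giambelli's determinants define a map \<open>giambelli k\<close> from \<open>F\<close>
  to the polynomials: a word of length \<open>k\<close> with letters \<open>\<epsilon>\<^sup>i\<close> goes to the determinant whose row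
  for the letter \<open>\<epsilon>\<^sup>i\<close> is \<open>(D\<^sub>i\<^sub>-\<^sub>1, \<dots>, D\<^sub>i\<^sub>-\<^sub>k)\<close>, and words of other lengths go to \<open>0\<close>. Modulo \<open>J\<close>
  the sequence \<open>D\<^sub>h\<close> satisfies \<open>D\<^sub>h\<^sub>+\<^sub>n = q D\<^sub>h\<close> for all \<open>h > -k\<close>, which makes the determinant
  \<open>\<int>[q]\<close>-linear in each factor; so \<open>I\<close> is mapped into \<open>J\<close>. Moreover the map turns the operator
  \<open>D\<^sub>j\<close> into multiplication by \<open>D\<^sub>j\<close> modulo \<open>J\<close>, and \<open>m\<^sub>0\<close> is sent to \<open>1\<close>. Therefore \<open>p(D) m\<^sub>0\<close> is
  sent to \<open>p\<close> modulo \<open>J\<close>, and if \<open>p\<close> acts as zero, then \<open>p \<in> J\<close>.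
\<close>

section \<open>Additive maps on finitely supported functions\<close>

lemma sum_single_keys:
  "(\<Sum>k\<in>Poly_Mapping.keys p. Poly_Mapping.single k (Poly_Mapping.lookup p k)) = p"
  by (rule poly_mapping_eqI)
    (auto simp: lookup_sum lookup_single when_def in_keys_iff sum.delta)

lemma poly_mapping_add_induct:
  assumes single: "\<And>k c. P (Poly_Mapping.single k c)"
    and add: "\<And>p q. P p \<Longrightarrow> P q \<Longrightarrow> P (p + q)"
  shows "P (p :: 'a \<Rightarrow>\<^sub>0 'b::comm_monoid_add)"
proof -
  have "P (\<Sum>k\<in>A. Poly_Mapping.single k (Poly_Mapping.lookup p k))" if "finite A" for A
    using that
  proof induction
    case empty
    show ?case using single[of undefined 0] by simp
  next
    case (insert x A)
    then show ?case using single add by simp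
  qed
  moreover note sum_single_keys[of p]
  ultimately show ?thesis by (metis finite_keys)
qed

definition lin_ext ::
  "('a \<Rightarrow> 'b::zero \<Rightarrow> 'c::comm_monoid_add) \<Rightarrow> ('a \<Rightarrow>\<^sub>0 'b) \<Rightarrow> 'c"
  where "lin_ext g p = (\<Sum>k\<in>Poly_Mapping.keys p. g k (Poly_Mapping.lookup p k))"

lemma lin_ext_additive:
  fixes g :: "'a \<Rightarrow> 'b::ab_group_add \<Rightarrow> 'c::ab_group_add"
  assumes "\<And>k. Modules.additive (g k)"
  shows "Modules.additive (lin_ext g)"
proof
  fix p q :: "'a \<Rightarrow>\<^sub>0 'b"
  show "lin_ext g (p + q) = lin_ext g p + lin_ext g q"
    unfolding lin_ext_def
    by (rule setsum_keys_plus_distrib)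
      (use assms in \<open>auto simp: additive.zero additive.add\<close>)
qed

lemma lin_ext_single:
  assumes "g k 0 = 0"
  shows "lin_ext g (Poly_Mapping.single k c) = g k c"
  using assms by (auto simp: lin_ext_def)

section \<open>The free algebra\<close>

definition tensor :: "'m list \<Rightarrow> ('m, 'r::comm_ring_1) free_alg"
  where "tensor ws = Poly_Mapping.single (Word ws) 1"

lemma tensor_Nil [simp]: "tensor [] = 1"
  by (simp add: tensor_def flip: single_one zero_fword_def)

lemma tensor_append: "tensor (u @ v) = tensor u * tensor v"
  by (simp add: tensor_def mult_single plus_fword_def)

lemma tensor_Cons: "tensor (x # ws) = gen x * tensor ws"
  by (simp add: tensor_def gen_def mult_single plus_fword_def)

lemma tensor_single: "tensor [x] = gen x"
  by (simp add: tensor_def gen_def)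

lemma scal_mult_tensor: "scal c * tensor ws = Poly_Mapping.single (Word ws) c"
  by (simp add: scal_def tensor_def mult_single)

lemma scal_add: "scal (a + b) = scal a + scal b"
  by (simp add: scal_def single_add)

lemma scal_mult: "scal (a * b) = scal a * scal b"
  by (simp add: scal_def mult_single)

lemma scal_0 [simp]: "scal 0 = 0"
  by (simp add: scal_def)

lemma scal_1 [simp]: "scal 1 = 1"
  by (simp add: scal_def)

lemma scal_minus: "scal (- a) = - scal a"
  by (simp add: scal_def single_uminus)

lemma free_alg_induct [case_names word add]:
  assumes "\<And>c ws. P (scal c * tensor ws)"
    and "\<And>p q. P p \<Longrightarrow> P q \<Longrightarrow> P (p + q)"
  shows "P (p :: ('m, 'r::comm_ring_1) free_alg)"
proof (rule poly_mapping_add_induct)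
  fix w :: "'m fword" and c :: 'r
  show "P (Poly_Mapping.single w c)"
    using assms(1)[of c "letters w"] by (simp add: scal_mult_tensor)
qed (use assms in auto)

lemma scal_central: "p * scal c = scal c * (p :: ('m, 'r::comm_ring_1) free_alg)"
proof (induction p rule: free_alg_induct)
  case (word d ws)
  show ?case unfolding scal_mult_tensor by (simp add: scal_def mult_single mult.commute)
qed (simp add: algebra_simps)

definition homogeneous :: "nat \<Rightarrow> ('m, 'r::comm_ring_1) free_alg set"
  where "homogeneous k = {p. \<forall>w\<in>Poly_Mapping.keys p. length (letters w) = k}"

lemma homogeneous_0 [simp]: "0 \<in> homogeneous k"
  by (simp add: homogeneous_def)

lemma homogeneous_add:
  "p \<in> homogeneous k \<Longrightarrow> q \<in> homogeneous k \<Longrightarrow> p + q \<in> homogeneous k"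
  unfolding homogeneous_def using keys_add[of p q] by blast

lemma homogeneous_sum:
  "(\<And>i. i \<in> A \<Longrightarrow> f i \<in> homogeneous k) \<Longrightarrow> sum f A \<in> homogeneous k"
  by (induction A rule: infinite_finite_induct) (auto intro: homogeneous_add)

lemma homogeneous_mult:
  "p \<in> homogeneous k \<Longrightarrow> q \<in> homogeneous l \<Longrightarrow> p * q \<in> homogeneous (k + l)"
  unfolding homogeneous_def using keys_mult[of p q] by (fastforce simp: plus_fword_def)

lemma homogeneous_scal: "scal c \<in> homogeneous 0"
  by (simp add: homogeneous_def scal_def zero_fword_def)

lemma homogeneous_1 [simp]: "1 \<in> homogeneous 0"
  using homogeneous_scal[of 1] by (simp only: scal_1)

lemma homogeneous_scal_mult:
  "p \<in> homogeneous k \<Longrightarrow> scal c * p \<in> homogeneous k"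
  using homogeneous_mult[OF homogeneous_scal[of c]] by force

lemma homogeneous_gen: "gen x \<in> homogeneous 1"
  by (simp add: homogeneous_def gen_def)

lemma homogeneous_tensor: "tensor ws \<in> homogeneous (length ws)"
  by (simp add: homogeneous_def tensor_def)

lemma homogeneous_induct [consumes 1, case_names word add]:
  assumes "p \<in> homogeneous k"
    and "\<And>c ws. length ws = k \<Longrightarrow> P (scal c * tensor ws)"
    and "\<And>p q. P p \<Longrightarrow> P q \<Longrightarrow> P (p + q)"
  shows "P (p :: ('m, 'r::comm_ring_1) free_alg)"
proof -
  have sm: "P (\<Sum>w\<in>A. Poly_Mapping.single w (Poly_Mapping.lookup p w))"
    if "finite A" "\<forall>w\<in>A. length (letters w) = k" for A
    using that
  proof induction
    case empty
    show ?case using assms(2)[of "replicate k undefined" 0] by simp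
  next
    case (insert x A)
    then show ?case
      using assms(2)[of "letters x" "Poly_Mapping.lookup p x"] assms(3) by (simp add: scal_mult_tensor)
  qed
  note sum_single_keys[of p]
  with sm[of "Poly_Mapping.keys p"] assms(1) show ?thesis
    by (simp add: homogeneous_def)
qed

section \<open>Algebra homomorphisms into power series\<close>

text \<open>
  The homomorphism to power series that extends \<open>\<sigma>\<close>. Besides the series \<open>D\<^sub>t\<close> itself this
  covers its inverse, some of whose coefficients on generators are not generators and which is
  therefore not of the form \<^const>\<open>hs_free\<close>.
\<close>

definition alg_hom ::
  "('m \<Rightarrow> ('m, 'r::comm_ring_1) free_alg fps) \<Rightarrow> ('m, 'r) free_alg \<Rightarrow> ('m, 'r) free_alg fps"
  where "alg_hom \<sigma> =
    lin_ext (\<lambda>w c. fps_const (scal c) * prod_list (map \<sigma> (letters w)))"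

lemma additive_alg_hom: "Modules.additive (alg_hom \<sigma>)"
  unfolding alg_hom_def
  by (rule lin_ext_additive)
    (simp add: additive_def scal_add distrib_right flip: fps_const_add)

lemma alg_hom_tensor:
  "alg_hom \<sigma> (scal c * tensor ws) = fps_const (scal c) * prod_list (map \<sigma> ws)"
  by (simp add: alg_hom_def scal_mult_tensor lin_ext_single)

lemma fps_scal_central: "F * fps_const (scal c) = fps_const (scal c) * F"
  by (rule fps_ext) (simp add: scal_central)

lemma alg_hom_mult: "alg_hom \<sigma> (p * q) = alg_hom \<sigma> p * alg_hom \<sigma> q"
proof (induction p rule: free_alg_induct)
  case (word c ws)
  show ?case
  proof (induction q rule: free_alg_induct)
    case (word d vs)
    have "scal c * tensor ws * (scal d * tensor vs) = scal (c * d) * tensor (ws @ vs)"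
      unfolding scal_mult_tensor by (simp add: mult_single plus_fword_def)
    then have "alg_hom \<sigma> (scal c * tensor ws * (scal d * tensor vs))
        = fps_const (scal (c * d)) * (prod_list (map \<sigma> ws) * prod_list (map \<sigma> vs))"
      by (simp add: alg_hom_tensor)
    also have "\<dots> = fps_const (scal c) * (fps_const (scal d) * prod_list (map \<sigma> ws)) * prod_list (map \<sigma> vs)"
      by (simp add: scal_mult mult.assoc flip: fps_const_mult)
    also have "\<dots> = fps_const (scal c) * (prod_list (map \<sigma> ws) * fps_const (scal d)) * prod_list (map \<sigma> vs)"
      by (simp only: fps_scal_central[of "prod_list (map \<sigma> ws)"])
    finally show ?case by (simp add: alg_hom_tensor mult.assoc)
  qed (simp add: distrib_left additive.add[OF additive_alg_hom])
qed (simp add: distrib_right additive.add[OF additive_alg_hom])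

lemma alg_hom_scal: "alg_hom \<sigma> (scal c) = fps_const (scal c)"
  using alg_hom_tensor[of \<sigma> c "[]"] by simp

lemma alg_hom_gen: "alg_hom \<sigma> (gen x) = \<sigma> x"
  using alg_hom_tensor[of \<sigma> 1 "[x]"] by (simp add: tensor_single)

definition hom_coeff ::
  "('m \<Rightarrow> ('m, 'r::comm_ring_1) free_alg fps) \<Rightarrow> nat \<Rightarrow> ('m, 'r) free_alg \<Rightarrow> ('m, 'r) free_alg"
  where "hom_coeff \<sigma> j p = fps_nth (alg_hom \<sigma> p) j"

lemma additive_hom_coeff: "Modules.additive (hom_coeff \<sigma> j)"
  by (simp add: additive_def hom_coeff_def additive.add[OF additive_alg_hom])

lemmas hom_coeff_add = additive.add[OF additive_hom_coeff]
lemmas hom_coeff_0 = additive.zero[OF additive_hom_coeff]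
lemmas hom_coeff_diff = additive.diff[OF additive_hom_coeff]
lemmas hom_coeff_sum = additive.sum[OF additive_hom_coeff]

lemma hom_coeff_scal: "hom_coeff \<sigma> j (scal c * p) = scal c * hom_coeff \<sigma> j p"
  by (simp add: hom_coeff_def alg_hom_mult alg_hom_scal)

lemma hom_coeff_mult:
  "hom_coeff \<sigma> j (p * q) = (\<Sum>i=0..j. hom_coeff \<sigma> i p * hom_coeff \<sigma> (j - i) q)"
  by (simp add: hom_coeff_def alg_hom_mult fps_mult_nth)

lemma hom_coeff_gen: "hom_coeff \<sigma> j (gen x) = fps_nth (\<sigma> x) j"
  by (simp add: hom_coeff_def alg_hom_gen)

lemma hom_coeff_one: "hom_coeff \<sigma> j 1 = (if j = 0 then 1 else 0)"
  using alg_hom_scal[of \<sigma> 1] by (simp add: hom_coeff_def)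

lemma homogeneous_hom_coeff:
  assumes "\<And>i x. fps_nth (\<sigma> x) i \<in> homogeneous 1"
    and "p \<in> homogeneous k"
  shows "hom_coeff \<sigma> j p \<in> homogeneous k"
proof -
  have w: "hom_coeff \<sigma> j (tensor ws) \<in> homogeneous (length ws)" for ws j
  proof (induction ws arbitrary: j)
    case Nil
    show ?case by (simp add: hom_coeff_one)
  next
    case (Cons x ws)
    show ?case
      using homogeneous_mult[OF assms(1) Cons]
      by (auto simp: tensor_Cons hom_coeff_mult hom_coeff_gen intro!: homogeneous_sum)
  qed
  show ?thesis
    using assms(2) by (induction rule: homogeneous_induct)
      (auto simp: hom_coeff_scal hom_coeff_add intro: homogeneous_scal_mult homogeneous_add w)
qed

section \<open>The ideal of exterior relations\<close>

lemma ring_type_algebra: "ring (ring_of_type_algebra :: 'a::ring_1 ring)"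
proof -
  have "\<exists>y. x + y = 0" for x :: 'a
    using add.right_inverse by blast
  thus ?thesis
    unfolding ring_of_type_algebra_def using add.right_inverse
    by unfold_locales (auto simp: algebra_simps Units_def)
qed

lemma ideal_ext_ideal: "ideal (ext_ideal s) ring_of_type_algebra"
  unfolding ext_ideal_def
  by (rule ring.genideal_ideal[OF ring_type_algebra]) (simp add: ring_of_type_algebra_def)

lemma ext_ideal_0 [simp]: "0 \<in> ext_ideal s"
  and ext_ideal_add: "p \<in> ext_ideal s \<Longrightarrow> q \<in> ext_ideal s \<Longrightarrow> p + q \<in> ext_ideal s"
  and ext_ideal_mult_left: "p \<in> ext_ideal s \<Longrightarrow> u * p \<in> ext_ideal s"
  and ext_ideal_mult_right: "p \<in> ext_ideal s \<Longrightarrow> p * u \<in> ext_ideal s"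
  using additive_subgroup.zero_closed[OF ideal.axioms(1)[OF ideal_ext_ideal[of s]]]
    additive_subgroup.a_closed[OF ideal.axioms(1)[OF ideal_ext_ideal[of s]], of p q]
    ideal.I_l_closed[OF ideal_ext_ideal[of s], of p u]
    ideal.I_r_closed[OF ideal_ext_ideal[of s], of p u]
  by (simp_all add: ring_of_type_algebra_def)

lemma ext_ideal_minus: "p \<in> ext_ideal s \<Longrightarrow> - p \<in> ext_ideal s"
  using ext_ideal_mult_left[of p s "- 1"] by simp

lemma ext_ideal_diff:
  "p \<in> ext_ideal s \<Longrightarrow> q \<in> ext_ideal s \<Longrightarrow> p - q \<in> ext_ideal s"
  using ext_ideal_add[OF _ ext_ideal_minus, of p s q] by simp

lemma ext_ideal_sum:
  "(\<And>i. i \<in> A \<Longrightarrow> f i \<in> ext_ideal s) \<Longrightarrow> sum f A \<in> ext_ideal s"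
  by (induction A rule: infinite_finite_induct) (auto intro: ext_ideal_add)

lemma ext_relations_subset: "r \<in> ext_relations s \<Longrightarrow> r \<in> ext_ideal s"
  unfolding ext_ideal_def
  using ring.genideal_self[OF ring_type_algebra, of "ext_relations s"]
  by (auto simp: ring_of_type_algebra_def)

lemma ext_ideal_gen_add: "gen (x + y) - (gen x + gen y) \<in> ext_ideal s"
  and ext_ideal_gen_scale: "gen (s c x) - scal c * gen x \<in> ext_ideal s"
  and ext_ideal_gen_square: "gen x * gen x \<in> ext_ideal s"
  by (rule ext_relations_subset; force simp: ext_relations_def)+

text \<open>
  The set of those \<open>p\<close> for which \<open>P\<close> holds on all products \<open>u * p * v\<close> is a two-sided ideal as
  soon as \<open>P\<close> is closed under addition and holds on such multiples of the relations:
  multiplication and negation are absorbed by \<open>u\<close> and \<open>v\<close>, and \<open>0\<close> is a multiple of a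
  relation.
\<close>

lemma ext_ideal_induct [consumes 1, case_names rel add]:
  assumes "p \<in> ext_ideal s"
    and rel: "\<And>r u v. r \<in> ext_relations s \<Longrightarrow> P (u * r * v)"
    and add: "\<And>p q. P p \<Longrightarrow> P q \<Longrightarrow> P (p + q)"
  shows "P p"
proof -
  let ?R = "ring_of_type_algebra :: ('a, 'b) free_alg ring"
  define K where "K = {p. \<forall>u v. P (u * p * v)}"
  have K_neg: "- p \<in> K" if "p \<in> K" for p
  proof -
    have "u * - p * v = - u * p * v" for u v by simp
    with that show ?thesis unfolding K_def mem_Collect_eq by metis
  qed
  have P0: "P 0"
    using rel[of "gen 0 * gen 0" 0 0] by (auto simp: ext_relations_def)
  have inv: "inv\<^bsub>add_monoid ?R\<^esub> p = - p" for p
    using abelian_group.minus_equality[OF ring.is_abelian_group[OF ring_type_algebra], of "- p" p]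
    by (simp add: a_inv_def ring_of_type_algebra_def)
  have "ideal K ?R"
  proof (rule idealI[OF ring_type_algebra])
    show "subgroup K (add_monoid ?R)"
    proof
      show "inv\<^bsub>add_monoid ?R\<^esub> x \<in> K" if "x \<in> K" for x
        using that K_neg inv by simp
    qed (auto simp: K_def ring_of_type_algebra_def P0 distrib_left distrib_right intro: add)
  qed (auto simp: K_def ring_of_type_algebra_def mult.assoc[symmetric],
      auto simp: mult.assoc)
  then have "ext_ideal s \<subseteq> K"
    unfolding ext_ideal_def
    by (rule ring.genideal_minimal[OF ring_type_algebra]) (auto simp: K_def intro: rel)
  with assms(1) have "P (1 * p * 1)" by (auto simp: K_def simp del: mult_1_left mult_1_right)
  then show ?thesis by simp
qed

text \<open>
  Expand the square of \<open>gen (x + y)\<close>.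
\<close>

lemma anticommute: "gen x * gen y + gen y * gen x \<in> ext_ideal s"
proof -
  have a: "gen (x + y) - (gen x + gen y) \<in> ext_ideal s"
    by (rule ext_ideal_gen_add)
  have "gen x * gen y + gen y * gen x =
      gen (x + y) * gen (x + y) - gen x * gen x - gen y * gen y
      - (gen (x + y) - (gen x + gen y)) * gen (x + y)
      - (gen x + gen y) * (gen (x + y) - (gen x + gen y))"
    by (simp add: algebra_simps)
  also have "\<dots> \<in> ext_ideal s"
    by (intro ext_ideal_diff ext_ideal_gen_square ext_ideal_mult_left[OF a] ext_ideal_mult_right[OF a])
  finally show ?thesis .
qed

text \<open>
  Pair the \<open>i\<close>-th summand with the \<open>(j - i)\<close>-th one; a summand in the middle is a square. This
  is both the reason why \<open>D\<^sub>t\<close> respects the relation \<open>x \<and> x = 0\<close> and the cancellation behind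
  Pieri's formula.
\<close>

lemma palindromic_sum:
  fixes f :: "nat \<Rightarrow> _"
  shows "(\<Sum>i=0..j. gen (f i) * gen (f (j - i))) \<in> ext_ideal s"
proof (induction j arbitrary: f rule: induct_nat_012)
  case 0
  show ?case by (simp add: ext_ideal_gen_square)
next
  case 1
  show ?case using anticommute[of "f 0" "f 1"] by simp
next
  case (ge2 j)
  have "(\<Sum>i=0..Suc (Suc j). gen (f i) * gen (f (Suc (Suc j) - i)))
      = (\<Sum>i=0..j. gen (f (Suc i)) * gen (f (Suc (j - i))))
        + (gen (f 0) * gen (f (Suc (Suc j))) + gen (f (Suc (Suc j))) * gen (f 0))"
    by (subst sum.atLeast0_atMost_Suc_shift, subst sum.atLeast0_atMost_Suc)
      (simp add: Suc_diff_le add_ac)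
  also have "\<dots> \<in> ext_ideal s"
    using ge2(1)[of "\<lambda>i. f (Suc i)"] by (intro ext_ideal_add anticommute)
  finally show ?case .
qed

definition hs_series ::
  "(nat \<Rightarrow> 'm \<Rightarrow> 'm) \<Rightarrow> 'm \<Rightarrow> ('m, 'r::comm_ring_1) free_alg fps"
  where "hs_series d x = Abs_fps (\<lambda>j. gen (d j x))"

lemma hs_free_nth: "fps_nth (hs_free d p) j = hom_coeff (hs_series d) j p"
  by (simp add: hs_free_def hom_coeff_def alg_hom_def lin_ext_def hs_series_def[abs_def])

lemma hom_coeff_hs_gen: "hom_coeff (hs_series d) j (gen x) = gen (d j x)"
  by (simp add: hom_coeff_gen hs_series_def)

lemma hom_coeff_hs_ext_ideal:
  assumes add: "\<And>j x y. d j (x + y) = d j x + d j y"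
    and scale: "\<And>j c x. d j (s c x) = s c (d j x)"
    and "p \<in> ext_ideal s"
  shows "hom_coeff (hs_series d) j p \<in> ext_ideal s"
  using assms(3)
proof (induction arbitrary: j rule: ext_ideal_induct)
  case (rel r u v)
  have r: "hom_coeff (hs_series d) i r \<in> ext_ideal s" for i
    using rel palindromic_sum[of "\<lambda>i. d i _"]
    by (auto simp: ext_relations_def hom_coeff_diff hom_coeff_add hom_coeff_hs_gen hom_coeff_scal
        hom_coeff_mult[of _ _ "gen _" "gen _"] add scale
        intro: ext_ideal_gen_add ext_ideal_gen_scale)
  show ?case
    unfolding hom_coeff_mult[of _ _ "u * r" v] hom_coeff_mult[of _ _ u r]
    by (rule ext_ideal_sum, rule ext_ideal_mult_right, rule ext_ideal_sum,
        rule ext_ideal_mult_left, rule r)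
qed (simp add: hom_coeff_add ext_ideal_add)

section \<open>The shifts and the scalar action\<close>

lemma shift_eq: "shift j = lin_ext (\<lambda>i. Poly_Mapping.single (i + j))"
  by (rule ext) (simp add: shift_def lin_ext_def)

lemma additive_shift: "Modules.additive (shift j)"
  unfolding shift_eq by (rule lin_ext_additive) (simp add: additive_def single_add)

lemmas shift_add = additive.add[OF additive_shift]

lemma shift_single [simp]: "shift j (Poly_Mapping.single i c) = Poly_Mapping.single (i + j) c"
  by (simp add: shift_eq lin_ext_single)

lemma shift_shift: "shift a (shift b x) = shift (a + b) x"
  by (induction x rule: poly_mapping_add_induct) (simp_all add: shift_add add_ac)

lemma shift_0 [simp]: "shift 0 x = x"
  by (induction x rule: poly_mapping_add_induct) (simp_all add: shift_add)

lemma map_mult_add: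
  fixes x y :: "nat \<Rightarrow>\<^sub>0 int"
  shows "Poly_Mapping.map ((*) c) (x + y) = Poly_Mapping.map ((*) c) x + Poly_Mapping.map ((*) c) y"
  by (simp add: mult_map_scale_conv_mult distrib_left)

lemma shift_map_mult: "shift j (Poly_Mapping.map ((*) c) x) = Poly_Mapping.map ((*) c) (shift j x)"
  by (induction x rule: poly_mapping_add_induct) (simp_all add: shift_add map_mult_add)

lemma shift_funpow: "shift j ((shift n ^^ i) x) = (shift n ^^ i) (shift j x)"
  by (induction i) (simp_all add: shift_shift, metis add.commute shift_shift)

lemma shift_act: "shift j (act n c x) = act n c (shift j x)"
  by (simp add: act_def additive.sum[OF additive_shift] shift_map_mult shift_funpow)

text \<open>
  By the action of constants every element of \<open>M\<close> reduces to the \<open>\<epsilon>\<^sup>i\<close> modulo the exterior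
  relations, and by the action of \<open>q\<close> the element \<open>\<epsilon>\<^sup>i\<^sup>+\<^sup>n\<close> reduces to \<open>\<epsilon>\<^sup>i\<close>.
\<close>

lemma act_const: "act n [:c:] x = Poly_Mapping.map ((*) c) x"
  by (simp add: act_def)

lemma act_q: "act n [:0, 1:] x = shift n x"
  by (simp add: act_def mult_map_scale_conv_mult)

section \<open>The operators on the free algebra\<close>

abbreviation D_free ::
  "nat \<Rightarrow> (nat \<Rightarrow>\<^sub>0 int, 'r::comm_ring_1) free_alg \<Rightarrow> (nat \<Rightarrow>\<^sub>0 int, 'r) free_alg"
  where "D_free \<equiv> hom_coeff (hs_series shift)"

lemma D_free_ext_ideal:
  "p \<in> ext_ideal (act n) \<Longrightarrow> D_free j p \<in> ext_ideal (act n)"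
  by (rule hom_coeff_hs_ext_ideal) (simp_all add: shift_add shift_act)

lemma homogeneous_D_free: "p \<in> homogeneous k \<Longrightarrow> D_free j p \<in> homogeneous k"
  by (rule homogeneous_hom_coeff) (simp_all add: hs_series_def homogeneous_gen del: One_nat_def)

lemma D_free_0: "D_free 0 p = p"
proof (induction p rule: free_alg_induct)
  case (word c ws)
  have "D_free 0 (tensor ws :: (_, 'a) free_alg) = tensor ws"
    by (induction ws) (simp_all add: hom_coeff_one tensor_Cons hom_coeff_mult hom_coeff_hs_gen)
  then show ?case by (simp add: hom_coeff_scal)
qed (simp add: hom_coeff_add)

lemma D_free_gen_mult: "D_free j (gen x * p) = (\<Sum>a=0..j. gen (shift a x) * D_free (j - a) p)"
  by (simp add: hom_coeff_mult hom_coeff_hs_gen)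

text \<open>
  On a word both composites distribute two compositions, of \<open>i\<close> and of \<open>j\<close>, over the letters
  and add the shifts letter by letter; so they agree already before passing to the exterior
  algebra.
\<close>

lemma D_free_commute: "D_free i (D_free j p) = D_free j (D_free i p)"
proof (induction p rule: free_alg_induct)
  case (word c ws)
  have "D_free i (D_free j (tensor ws :: (_, 'a) free_alg)) = D_free j (D_free i (tensor ws))" for i j
  proof (induction ws arbitrary: i j)
    case Nil
    show ?case by (simp add: hom_coeff_one hom_coeff_0)
  next
    case (Cons x ws)
    have exp: "D_free i (D_free j (gen x * tensor ws)) =
      (\<Sum>a=0..j. \<Sum>b=0..i. gen (shift (b + a) x) * D_free (i - b) (D_free (j - a) (tensor ws)))" for i j
      by (simp add: D_free_gen_mult hom_coeff_sum shift_shift)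
    show ?case
      unfolding tensor_Cons exp
      by (subst sum.swap) (simp add: Cons add.commute)
  qed
  then show ?case by (simp add: hom_coeff_scal)
qed (simp add: hom_coeff_add)

section \<open>Pieri's formula for an initial word\<close>

abbreviation eps :: "nat \<Rightarrow> (nat \<Rightarrow>\<^sub>0 int)"
  where "eps i \<equiv> Poly_Mapping.single i 1"

text \<open>
  The word \<open>\<epsilon>\<^sup>1 \<dots> \<epsilon>\<^sup>k\<close>; as \<open>eps i\<close> stands for \<open>\<epsilon>\<^sup>i\<^sup>+\<^sup>1\<close>, its last letter is \<open>eps (k - 1)\<close>.
\<close>

definition m0 :: "nat \<Rightarrow> (nat \<Rightarrow>\<^sub>0 int, 'r::comm_ring_1) free_alg"
  where "m0 k = tensor (map eps [0..<k])"

lemma m0_0 [simp]: "m0 0 = 1"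
  by (simp add: m0_def)

lemma m0_Suc: "m0 (Suc k) = m0 k * gen (eps k)"
  by (simp add: m0_def tensor_append tensor_single)

lemma homogeneous_m0: "m0 k \<in> homogeneous k"
  using homogeneous_tensor[of "map eps [0..<k]"] by (simp add: m0_def)

lemma ext_ideal_transfer:
  "p - q \<in> ext_ideal s \<Longrightarrow> q \<in> ext_ideal s \<Longrightarrow> p \<in> ext_ideal s"
  using ext_ideal_add[of "p - q" s q] by simp

text \<open>
  Move the new letter to the left until it meets its copy.
\<close>

lemma m0_repeat: "i < k \<Longrightarrow> m0 k * gen (eps i) \<in> ext_ideal s"
proof (induction k)
  case (Suc k)
  show ?case
  proof (cases "i = k")
    case True
    then show ?thesis
      using ext_ideal_mult_left[OF ext_ideal_gen_square] by (simp add: m0_Suc mult.assoc)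
  next
    case False
    with Suc have IH: "m0 k * gen (eps i) \<in> ext_ideal s" by simp
    have "m0 (Suc k) * gen (eps i) =
        m0 k * (gen (eps k) * gen (eps i) + gen (eps i) * gen (eps k))
        - m0 k * gen (eps i) * gen (eps k)"
      by (simp add: m0_Suc algebra_simps)
    also have "\<dots> \<in> ext_ideal s"
      by (intro ext_ideal_diff ext_ideal_mult_left anticommute ext_ideal_mult_right[OF IH])
    finally show ?thesis .
  qed
qed simp

text \<open>
  Let \<open>\<epsilon>\<^sup>r\<close> and \<open>\<epsilon>\<^sup>r\<^sup>+\<^sup>1\<close> be the last two letters. Split off \<open>\<epsilon>\<^sup>r\<^sup>+\<^sup>1\<close> and apply the formula to the
  shorter word: \<open>i\<close> of the \<open>h\<close> steps move \<open>\<epsilon>\<^sup>r\<close> and the other \<open>h - i\<close> move \<open>\<epsilon>\<^sup>r\<^sup>+\<^sup>1\<close>. The terms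
  with \<open>i \<ge> 1\<close> cancel in pairs, as \<open>\<epsilon>\<^sup>r\<^sup>+\<^sup>i \<and> \<epsilon>\<^sup>r\<^sup>+\<^sup>1\<^sup>+\<^sup>h\<^sup>-\<^sup>i\<close> changes its sign when \<open>i\<close> is replaced by
  \<open>h + 1 - i\<close>.
\<close>

lemma pieri: "D_free h (m0 (Suc k)) - m0 k * gen (eps (k + h)) \<in> ext_ideal s"
proof (induction k arbitrary: h)
  case 0
  show ?case by (simp add: m0_Suc hom_coeff_hs_gen del: single_one)
next
  case (Suc k)
  let ?t = "\<lambda>i. m0 k * gen (eps (k + i)) * gen (eps (Suc k + (h - i)))"
  have eq: "D_free h (m0 (Suc (Suc k))) = (\<Sum>i=0..h. D_free i (m0 (Suc k)) * gen (eps (Suc k + (h - i))))"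
    by (subst m0_Suc) (simp add: hom_coeff_mult hom_coeff_hs_gen)
  have "D_free h (m0 (Suc (Suc k))) - (\<Sum>i=0..h. ?t i)
      = (\<Sum>i=0..h. (D_free i (m0 (Suc k)) - m0 k * gen (eps (k + i))) * gen (eps (Suc k + (h - i))))"
    unfolding eq by (simp add: sum_subtractf left_diff_distrib)
  also have "\<dots> \<in> ext_ideal s"
    by (intro ext_ideal_sum ext_ideal_mult_right Suc)
  finally have A: "D_free h (m0 (Suc (Suc k))) - (\<Sum>i=0..h. ?t i) \<in> ext_ideal s" .
  have B: "(\<Sum>i=0..h. ?t i) - m0 (Suc k) * gen (eps (Suc k + h)) \<in> ext_ideal s"
  proof (cases h)
    case (Suc h')
    have "(\<Sum>i=0..h. ?t i) - m0 (Suc k) * gen (eps (Suc k + h))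
        = m0 k * (\<Sum>i=0..h'. gen (eps (Suc k + i)) * gen (eps (Suc k + (h' - i))))"
      unfolding Suc
      by (subst sum.atLeast0_atMost_Suc_shift) (simp add: m0_Suc sum_distrib_left mult.assoc)
    also have "\<dots> \<in> ext_ideal s"
      by (intro ext_ideal_mult_left palindromic_sum[of "\<lambda>i. eps (Suc k + i)"])
    finally show ?thesis .
  qed (simp add: m0_Suc)
  show ?case using ext_ideal_add[OF A B] by simp
qed

section \<open>Generation of the exterior power by one element\<close>

text \<open>
  The preimage in the free algebra of the \<open>\<int>[q][D]\<close>-submodule generated by \<open>m\<^sub>0\<close>.
\<close>

inductive_set cyclic_span :: "nat \<Rightarrow> nat \<Rightarrow> (nat \<Rightarrow>\<^sub>0 int, int poly) free_alg set" for n k where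
  base: "m0 k \<in> cyclic_span n k"
| ideal: "p \<in> ext_ideal (act n) \<Longrightarrow> p \<in> cyclic_span n k"
| add: "p \<in> cyclic_span n k \<Longrightarrow> q \<in> cyclic_span n k \<Longrightarrow> p + q \<in> cyclic_span n k"
| scale: "p \<in> cyclic_span n k \<Longrightarrow> scal c * p \<in> cyclic_span n k"
| D_free: "p \<in> cyclic_span n k \<Longrightarrow> D_free j p \<in> cyclic_span n k"

lemma cyclic_span_diff:
  "p \<in> cyclic_span n k \<Longrightarrow> q \<in> cyclic_span n k \<Longrightarrow> p - q \<in> cyclic_span n k"
  using cyclic_span.add[OF _ cyclic_span.scale[of q n k "- 1"], of p] by (simp add: scal_minus)

lemma cyclic_span_sum:
  "(\<And>i. i \<in> A \<Longrightarrow> f i \<in> cyclic_span n k) \<Longrightarrow> sum f A \<in> cyclic_span n k"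
  by (induction A rule: infinite_finite_induct) (auto intro: cyclic_span.add cyclic_span.ideal)

lemma cyclic_span_transfer:
  "p - q \<in> ext_ideal (act n) \<Longrightarrow> q \<in> cyclic_span n k \<Longrightarrow> p \<in> cyclic_span n k"
  by (metis cyclic_span.add cyclic_span.ideal diff_add_cancel)

text \<open>
  For \<open>p = m\<^sub>0\<close> and \<open>x = \<epsilon>\<^sup>i\<close> the product vanishes if \<open>i \<le> k\<close> and is given by Pieri's formula
  otherwise. The property passes from \<open>p\<close> to \<open>D\<^sub>j p\<close> by integration by parts: solve the Leibniz
  rule for \<open>D\<^sub>j (p * x)\<close> for the term \<open>D\<^sub>j p * x\<close>; the other terms contain only \<open>D\<^sub>i p\<close> with
  \<open>i < j\<close>.
\<close>

lemma cyclic_span_mult_gen: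
  "p \<in> cyclic_span n k \<Longrightarrow> p * gen x \<in> cyclic_span n (Suc k)"
proof (induction arbitrary: x rule: cyclic_span.induct)
  case base
  show ?case
  proof (induction x rule: poly_mapping_add_induct)
    case (1 i c)
    have "Poly_Mapping.single i c = act n [:c:] (eps i)"
      by (simp add: act_const)
    then have "gen (Poly_Mapping.single i c) - scal [:c:] * gen (eps i) \<in> ext_ideal (act n)"
      using ext_ideal_gen_scale[of "act n" "[:c:]" "eps i"] by simp
    from ext_ideal_mult_left[OF this, of "m0 k"]
    have "m0 k * gen (Poly_Mapping.single i c) - scal [:c:] * (m0 k * gen (eps i)) \<in> ext_ideal (act n)"
      by (simp add: right_diff_distrib scal_central[of "m0 k"] flip: mult.assoc)
    moreover have "m0 k * gen (eps i) \<in> cyclic_span n (Suc k)"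
    proof (cases "i < k")
      case True
      then show ?thesis by (intro cyclic_span.ideal m0_repeat)
    next
      case False
      have "m0 k * gen (eps i) - D_free (i - k) (m0 (Suc k)) \<in> ext_ideal (act n)"
        using ext_ideal_minus[OF pieri[of "i - k" k "act n"]] False by simp
      then show ?thesis by (rule cyclic_span_transfer) (intro cyclic_span.D_free cyclic_span.base)
    qed
    ultimately show ?case by (blast intro: cyclic_span_transfer cyclic_span.scale)
  next
    case (2 x y)
    have "m0 k * gen (x + y) - (m0 k * gen x + m0 k * gen y) \<in> ext_ideal (act n)"
      using ext_ideal_mult_left[OF ext_ideal_gen_add[of x y "act n"], of "m0 k"]
      by (simp add: algebra_simps)
    then show ?case using 2 by (blast intro: cyclic_span_transfer cyclic_span.add)
  qed
next
  case (ideal p)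
  then show ?case by (intro cyclic_span.ideal ext_ideal_mult_right)
next
  case (add p q)
  then show ?case by (simp add: distrib_right cyclic_span.add)
next
  case (scale p c)
  then show ?case by (simp add: mult.assoc cyclic_span.scale)
next
  case (D_free p j)
  show ?case
  proof (induction j arbitrary: x rule: less_induct)
    case (less j)
    have "D_free j (p * gen x) = (\<Sum>i\<in>{0..<j}. D_free i p * gen (shift (j - i) x)) + D_free j p * gen x"
      by (simp add: hom_coeff_mult hom_coeff_hs_gen atLeastLessThanSuc_atLeastAtMost[symmetric])
    then have "D_free j p * gen x = D_free j (p * gen x) - (\<Sum>i\<in>{0..<j}. D_free i p * gen (shift (j - i) x))"
      by simp
    also have "\<dots> \<in> cyclic_span n (Suc k)"
      by (intro cyclic_span_diff cyclic_span_sum cyclic_span.D_free D_free.IH less) simp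
    finally show ?case .
  qed
qed

lemma homogeneous_subset_cyclic_span: "homogeneous k \<subseteq> cyclic_span n k"
proof
  fix p :: "(nat \<Rightarrow>\<^sub>0 int, int poly) free_alg"
  have "tensor ws \<in> cyclic_span n (length ws)" for ws
  proof (induction ws rule: rev_induct)
    case Nil
    show ?case using cyclic_span.base[of 0 n] by simp
  qed (simp add: tensor_append tensor_single cyclic_span_mult_gen)
  then show "p \<in> cyclic_span n k" if "p \<in> homogeneous k"
    by (rule_tac homogeneous_induct[OF that]) (auto intro: cyclic_span.add cyclic_span.scale)
qed

section \<open>The inverse series\<close>

text \<open>
  On \<open>M\<close> we have \<open>D\<^sub>t = \<Sum>\<^sub>j D\<^sub>1\<^sup>j t\<^sup>j\<close>, with inverse \<open>1 - D\<^sub>1 t\<close>.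
\<close>

definition inv_series ::
  "(nat \<Rightarrow>\<^sub>0 int) \<Rightarrow> (nat \<Rightarrow>\<^sub>0 int, 'r::comm_ring_1) free_alg fps"
  where "inv_series x =
    Abs_fps (\<lambda>j. if j = 0 then gen x else if j = 1 then - gen (shift 1 x) else 0)"

abbreviation D_free_inv ::
  "nat \<Rightarrow> (nat \<Rightarrow>\<^sub>0 int, 'r::comm_ring_1) free_alg \<Rightarrow> (nat \<Rightarrow>\<^sub>0 int, 'r) free_alg"
  where "D_free_inv \<equiv> hom_coeff inv_series"

lemma D_free_inv_gen_mult:
  "D_free_inv j (gen x * p) = gen x * D_free_inv j p - (if j = 0 then 0 else gen (shift 1 x) * D_free_inv (j - 1) p)"
proof (cases j)
  case (Suc i)
  have "D_free_inv j (gen x * p) = (\<Sum>i\<in>{0, 1}. D_free_inv i (gen x) * D_free_inv (j - i) p)"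
    unfolding hom_coeff_mult
    by (rule sum.mono_neutral_right) (auto simp: Suc hom_coeff_gen inv_series_def)
  then show ?thesis by (simp add: Suc hom_coeff_gen inv_series_def)
qed (simp add: hom_coeff_mult hom_coeff_gen inv_series_def)

text \<open>
  Each letter contributes at most one factor \<open>t\<close>.
\<close>

lemma D_free_inv_vanish:
  "p \<in> homogeneous k \<Longrightarrow> k < j \<Longrightarrow> D_free_inv j p = 0"
proof (induction rule: homogeneous_induct)
  case (word c ws)
  have "length ws < j \<Longrightarrow> D_free_inv j (tensor ws :: (_, 'a) free_alg) = 0" for ws j
    by (induction ws arbitrary: j) (auto simp: hom_coeff_one tensor_Cons D_free_inv_gen_mult)
  with word show ?case by (simp add: hom_coeff_scal)
qed (simp add: hom_coeff_add)

lemma sum_triangle_swap: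
  fixes F :: "nat \<Rightarrow> nat \<Rightarrow> 'a::comm_monoid_add"
  shows "(\<Sum>j=0..h. \<Sum>a=0..h-j. F j a) = (\<Sum>a=0..h. \<Sum>j=0..h-a. F j a)"
  unfolding sum.Sigma[OF finite_atLeastAtMost ballI[OF finite_atLeastAtMost]]
  by (rule sum.reindex_bij_witness[where i = prod.swap and j = prod.swap]) auto

lemma D_free_inv_0: "D_free_inv 0 p = p"
proof (induction p rule: free_alg_induct)
  case (word c ws)
  have "D_free_inv 0 (tensor ws :: (_, 'a) free_alg) = tensor ws"
    by (induction ws) (simp_all add: hom_coeff_one tensor_Cons D_free_inv_gen_mult)
  then show ?case by (simp add: hom_coeff_scal)
qed (simp add: hom_coeff_add)

text \<open>
  Splitting off the first letter \<open>x\<close> of a word leaves, by the induction hypothesis for the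
  remaining letters, two terms with first letters \<open>D\<^sub>h x\<close> and \<open>D\<^sub>1 D\<^sub>h\<^sub>-\<^sub>1 x\<close>. They are the same
  element of \<open>M\<close>, so the terms cancel already in the free algebra.
\<close>

lemma D_free_left_inverse:
  "(\<Sum>j=0..h. D_free_inv j (D_free (h - j) p)) = (if h = 0 then p else 0)"
proof (induction p rule: free_alg_induct)
  case (word c ws)
  have "(\<Sum>j=0..h. D_free_inv j (D_free (h - j) (tensor ws))) = (if h = 0 then tensor ws else 0 :: (_, 'a) free_alg)"
  proof (induction ws arbitrary: h)
    case Nil
    show ?case by (cases h) (simp_all add: hom_coeff_one hom_coeff_0 if_distrib cong: if_cong)
  next
    case (Cons x ws)
    have tri: "(\<Sum>j=0..h. \<Sum>a=0..h-j. g a * D_free_inv j (D_free (h - j - a) (tensor ws))) = g h * tensor ws"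
      for g :: "nat \<Rightarrow> (_, 'a) free_alg" and h
    proof -
      have "(\<Sum>j=0..h. \<Sum>a=0..h-j. g a * D_free_inv j (D_free (h - j - a) (tensor ws)))
          = (\<Sum>a=0..h. g a * (\<Sum>j=0..h-a. D_free_inv j (D_free (h - a - j) (tensor ws))))"
        by (subst sum_triangle_swap) (simp add: sum_distrib_left add.commute)
      also have "\<dots> = (\<Sum>a=0..h. g a * (if h - a = 0 then tensor ws else 0))"
        by (simp only: Cons)
      also have "\<dots> = (\<Sum>a=0..h. if a = h then g h * tensor ws else 0)"
        by (intro sum.cong) auto
      finally show ?thesis by simp
    qed
    let ?w = "tensor ws :: (_, 'a) free_alg"
    have "(\<Sum>j=0..h. D_free_inv j (D_free (h - j) (gen x * ?w))) =
        (\<Sum>j=0..h. \<Sum>a=0..h-j. gen (shift a x) * D_free_inv j (D_free (h - j - a) ?w))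
        - (\<Sum>j=0..h. \<Sum>a=0..h-j. if j = 0 then 0
            else gen (shift (Suc a) x) * D_free_inv (j - 1) (D_free (h - j - a) ?w))"
      by (simp add: D_free_gen_mult hom_coeff_sum D_free_inv_gen_mult sum_subtractf shift_shift cong: if_cong)
    also have "(\<Sum>j=0..h. \<Sum>a=0..h-j. if j = 0 then 0
            else gen (shift (Suc a) x) * D_free_inv (j - 1) (D_free (h - j - a) ?w))
        = (if h = 0 then 0 else gen (shift h x) * ?w)"
    proof (cases h)
      case (Suc h')
      show ?thesis
        unfolding Suc
        by (subst sum.atLeast0_atMost_Suc_shift)
          (use tri[where g = "\<lambda>a. gen (shift (Suc a) x)" and h = h'] in simp)
    qed simp
    finally show ?case
      using tri[where g = "\<lambda>a. gen (shift a x)" and h = h] by (auto simp: tensor_Cons D_free_0 D_free_inv_0)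
  qed
  then show ?case by (simp add: hom_coeff_scal flip: sum_distrib_left)
qed (simp add: hom_coeff_add sum.distrib)

lemma D_free_inv_rec:
  "0 < h \<Longrightarrow> D_free_inv h p = - (\<Sum>i=1..h. D_free_inv (h - i) (D_free i p))"
proof -
  assume "0 < h"
  have "0 = (\<Sum>i=0..h. D_free_inv (h - i) (D_free i p))"
    using D_free_left_inverse[of h p] \<open>0 < h\<close> by (subst sum.atLeastAtMost_rev) simp
  also have "\<dots> = D_free_inv h p + (\<Sum>i=1..h. D_free_inv (h - i) (D_free i p))"
    by (simp add: sum.atLeast_Suc_atMost D_free_0)
  finally show ?thesis by (simp add: eq_neg_iff_add_eq_0)
qed

section \<open>Polynomials in the first indeterminates\<close>

definition polys :: "nat \<Rightarrow> mpoly_q set"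
  where "polys k = {p. \<forall>m\<in>Poly_Mapping.keys p. Poly_Mapping.keys m \<subseteq> {1..k}}"

lemma polys_add:
  "p \<in> polys k \<Longrightarrow> q \<in> polys k \<Longrightarrow> p + q \<in> polys k"
  unfolding polys_def using keys_add[of p q] by blast

lemma polys_mult:
  "p \<in> polys k \<Longrightarrow> q \<in> polys k \<Longrightarrow> p * q \<in> polys k"
proof -
  assume pq: "p \<in> polys k" "q \<in> polys k"
  have "Poly_Mapping.keys (a + b) \<subseteq> {1..k}"
    if "a \<in> Poly_Mapping.keys p" "b \<in> Poly_Mapping.keys q" for a b
    using that pq keys_add[of a b] unfolding polys_def by blast
  with keys_mult[of p q] show ?thesis unfolding polys_def by blast
qed

lemma polys_minus: "p \<in> polys k \<Longrightarrow> - p \<in> polys k"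
  by (simp add: polys_def)

lemma polys_diff:
  "p \<in> polys k \<Longrightarrow> q \<in> polys k \<Longrightarrow> p - q \<in> polys k"
  using polys_add[OF _ polys_minus, of p k q] by simp

lemma polys_const [simp]: "const c \<in> polys k"
  by (simp add: polys_def const_def)

lemma polys_indet: "i \<in> {1..k} \<Longrightarrow> indet i \<in> polys k"
  by (simp add: polys_def indet_def)

lemma const_1 [simp]: "const 1 = 1" and const_0 [simp]: "const 0 = 0"
  by (simp_all add: const_def)

lemma const_add: "const (a + b) = const a + const b"
  by (simp add: const_def single_add)

lemma const_mult: "const (a * b) = const a * const b"
  by (simp add: const_def mult_single)

lemma polys_0 [simp]: "0 \<in> polys k" and polys_1 [simp]: "1 \<in> polys k"
  using polys_const[of 0 k] polys_const[of 1 k] by simp_all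

lemma polys_sum:
  "(\<And>i. i \<in> A \<Longrightarrow> f i \<in> polys k) \<Longrightarrow> sum f A \<in> polys k"
  by (induction A rule: infinite_finite_induct) (auto intro: polys_add)

lemma polys_prod:
  "(\<And>i. i \<in> A \<Longrightarrow> f i \<in> polys k) \<Longrightarrow> prod f A \<in> polys k"
  by (induction A rule: infinite_finite_induct) (auto intro: polys_mult)

lemma polys_mono: "k \<le> l \<Longrightarrow> polys k \<subseteq> polys l"
proof -
  assume "k \<le> l"
  then have "{1..k} \<subseteq> {1..l}" by simp
  then show ?thesis unfolding polys_def by blast
qed

lemma polys_induct [consumes 1, case_names const indet add mult]:
  assumes "p \<in> polys k"
    and const: "\<And>c. P (const c)" and indet: "\<And>i. i \<in> {1..k} \<Longrightarrow> P (indet i)"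
    and add: "\<And>p q. p \<in> polys k \<Longrightarrow> q \<in> polys k \<Longrightarrow> P p \<Longrightarrow> P q \<Longrightarrow> P (p + q)"
    and mult: "\<And>p q. p \<in> polys k \<Longrightarrow> q \<in> polys k \<Longrightarrow> P p \<Longrightarrow> P q \<Longrightarrow> P (p * q)"
  shows "P p"
proof -
  have P1: "P 1" using const[of 1] by simp
  have pow: "P (indet i ^ a) \<and> indet i ^ a \<in> polys k" if "i \<in> {1..k}" for i a
    by (induction a)
      (use mult indet[OF that] polys_mult polys_indet[OF that] P1 in \<open>auto simp del: atLeastAtMost_iff\<close>)
  have pow_eq: "indet i ^ a = Poly_Mapping.single (Poly_Mapping.single i a) 1" for i a
    by (induction a) (simp_all add: indet_def mult_single flip: single_add)
  have D_monomial: "P (\<Prod>i\<in>A. indet i ^ f i) \<and> (\<Prod>i\<in>A. indet i ^ f i) \<in> polys k"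
    if "finite A" "A \<subseteq> {1..k}" for A f
    using that
  proof (induction A)
    case (insert x A)
    then show ?case using pow[of x "f x"] by (simp add: mult polys_mult)
  qed (simp add: P1)
  have D_monomial_eq: "Poly_Mapping.single m 1 = (\<Prod>i\<in>Poly_Mapping.keys m. indet i ^ Poly_Mapping.lookup m i)"
    for m :: "nat \<Rightarrow>\<^sub>0 nat"
  proof -
    have "(\<Prod>i\<in>A. indet i ^ f i) = Poly_Mapping.single (\<Sum>i\<in>A. Poly_Mapping.single i (f i)) 1"
      if "finite A" for A f
      using that by (induction A) (simp_all add: pow_eq mult_single)
    moreover note sum_single_keys[of m]
    ultimately show ?thesis by simp
  qed
  have single: "P (Poly_Mapping.single m c) \<and> Poly_Mapping.single m c \<in> polys k"
    if "Poly_Mapping.keys m \<subseteq> {1..k}" for m c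
  proof -
    have "Poly_Mapping.single m c = const c * Poly_Mapping.single m 1"
      by (simp add: const_def mult_single)
    then show ?thesis
      using D_monomial[OF _ that] by (auto simp: D_monomial_eq intro: mult const polys_mult)
  qed
  have "P (\<Sum>m\<in>A. Poly_Mapping.single m (f m)) \<and> (\<Sum>m\<in>A. Poly_Mapping.single m (f m)) \<in> polys k"
    if "finite A" "\<forall>m\<in>A. Poly_Mapping.keys m \<subseteq> {1..k}" for A f
    using that by (induction A) (use const[of 0] single in \<open>auto intro: add polys_add\<close>)
  moreover note sum_single_keys[of p]
  moreover have "\<forall>m\<in>Poly_Mapping.keys p. Poly_Mapping.keys m \<subseteq> {1..k}"
    using assms(1) by (simp add: polys_def)
  ultimately show ?thesis by (metis (no_types) finite_keys)
qed

section \<open>The polynomials for the higher operators\<close>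

lemma inv_coeff_conv:
  "(\<Sum>i=0..j. (if i = 0 then 1 else indet i) * inv_coeff (j - i)) = (if j = 0 then 1 else 0)"
proof -
  let ?X = "Abs_fps (\<lambda>i. if i = 0 then 1 else indet i)"
  have "?X * fps_right_inverse ?X 1 = 1"
    by (rule fps_right_inverse) simp
  then have "fps_nth (?X * fps_right_inverse ?X 1) j = fps_nth 1 j" by simp
  then show ?thesis by (simp add: fps_mult_nth inv_coeff_def)
qed

lemma inv_coeff_0 [simp]: "inv_coeff 0 = 1"
  using inv_coeff_conv[of 0] by simp

lemma inv_coeff_rec:
  "0 < j \<Longrightarrow> inv_coeff j = - (\<Sum>i=1..j. indet i * inv_coeff (j - i))"
proof -
  assume "0 < j"
  then have "inv_coeff j + (\<Sum>i=1..j. indet i * inv_coeff (j - i)) = 0"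
    using inv_coeff_conv[of j] by (simp add: sum.atLeast_Suc_atMost[of 0])
  then show ?thesis by (simp only: eq_neg_iff_add_eq_0)
qed

lemma inv_coeff_polys: "inv_coeff j \<in> polys j"
proof (induction j rule: less_induct)
  case (less j)
  show ?case
  proof (cases "j = 0")
    case False
    have "indet i * inv_coeff (j - i) \<in> polys j" if "i \<in> {1..j}" for i
      using that less[of "j - i"] polys_mono[of "j - i" j] by (intro polys_mult polys_indet) auto
    moreover have "0 < j" using False by simp
    ultimately show ?thesis
      unfolding inv_coeff_rec[OF \<open>0 < j\<close>] by (intro polys_minus polys_sum)
  qed simp
qed

lemma D_poly_polys: "D_poly k h \<in> polys k"
proof (induction h rule: less_induct)
  case (less h)
  have "inv_coeff j * D_poly k (h - j) \<in> polys k" if "k < h" "j \<in> {1..k}" for j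
    using that less[of "h - j"] inv_coeff_polys[of j] polys_mono[of j k] by (intro polys_mult) auto
  then have "- (\<Sum>j=1..k. inv_coeff j * D_poly k (h - j)) \<in> polys k" if "k < h"
    using that by (intro polys_minus polys_sum)
  then show ?case
    by (subst D_poly.simps) (simp add: polys_indet)
qed

text \<open>
  The same polynomials with an integer index, so that the convention \<open>D\<^sub>h = 0\<close> for \<open>h < 0\<close> can
  be used in determinants.
\<close>

definition D_int :: "nat \<Rightarrow> int \<Rightarrow> mpoly_q"
  where "D_int k h = (if h < 0 then 0 else D_poly k (nat h))"

lemma D_int_polys: "D_int k h \<in> polys k"
  by (simp add: D_int_def D_poly_polys)

lemma D_int_0 [simp]: "D_int k 0 = 1"
  by (simp add: D_int_def D_poly.simps)

lemma D_int_neg [simp]: "h < 0 \<Longrightarrow> D_int k h = 0"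
  by (simp add: D_int_def)

text \<open>
  The recursion that defines \<open>D\<^sub>h\<close> for \<open>h > k\<close> also holds for \<open>1 \<le> h \<le> k\<close>, where it expresses
  that the \<open>a\<^sub>j\<close> are the coefficients of the inverse series.
\<close>

lemma D_int_rec:
  assumes "1 \<le> h"
  shows "D_int k h = - (\<Sum>j=1..k. inv_coeff j * D_int k (h - int j))"
proof -
  define l where "l = nat h"
  have l: "h = int l" "l \<ge> 1" using assms by (auto simp: l_def)
  show ?thesis
  proof (cases "l \<le> k")
    case False
    have "D_int k h = - (\<Sum>j=1..k. inv_coeff j * D_poly k (l - j))"
      using False l by (simp add: D_int_def D_poly.simps[of k l])
    also have "(\<Sum>j=1..k. inv_coeff j * D_poly k (l - j)) = (\<Sum>j=1..k. inv_coeff j * D_int k (h - int j))"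
      using False by (intro sum.cong) (auto simp: D_int_def l simp flip: of_nat_diff)
    finally show ?thesis .
  next
    case True
    let ?X = "\<lambda>i. if i = 0 then 1 else indet i"
    have X: "D_poly k i = ?X i" if "i \<le> l" for i
      using that True by (subst D_poly.simps) auto
    have "0 = (\<Sum>i=0..l. ?X i * inv_coeff (l - i))"
      using inv_coeff_conv[of l] l by simp
    also have "\<dots> = (\<Sum>j=0..l. ?X (l - j) * inv_coeff j)"
      by (subst sum.atLeastAtMost_rev) (simp cong: if_cong)
    also have "\<dots> = D_poly k l + (\<Sum>j=1..l. ?X (l - j) * inv_coeff j)"
      by (subst sum.atLeast_Suc_atMost) (simp_all only: le0 diff_zero X[OF le_refl] inv_coeff_0 mult_1_right One_nat_def)
    also have "(\<Sum>j=1..l. ?X (l - j) * inv_coeff j) = (\<Sum>j=1..l. inv_coeff j * D_int k (h - int j))"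
      by (intro sum.cong) (auto simp: D_int_def l X mult.commute simp flip: of_nat_diff)
    also have "\<dots> = (\<Sum>j=1..k. inv_coeff j * D_int k (h - int j))"
      using True l by (intro sum.mono_neutral_left) auto
    finally show ?thesis using l by (simp add: D_int_def eq_neg_iff_add_eq_0)
  qed
qed

section \<open>Polynomials as operators\<close>

text \<open>
  The monomial \<open>m\<close> as an operator. The factors are composed in the order of the indices to
  have a definite function; the order is irrelevant as the operators commute.
\<close>

primrec D_monomial :: "nat \<Rightarrow> (nat \<Rightarrow>\<^sub>0 nat) \<Rightarrow> (nat \<Rightarrow>\<^sub>0 int, 'r::comm_ring_1) free_alg \<Rightarrow> (nat \<Rightarrow>\<^sub>0 int, 'r) free_alg"
  where "D_monomial 0 m x = x"
  | "D_monomial (Suc k) m x = (D_free (Suc k) ^^ Poly_Mapping.lookup m (Suc k)) (D_monomial k m x)"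

lemma D_free_pow_add: "(D_free i ^^ a) (x + y) = (D_free i ^^ a) x + (D_free i ^^ a) y"
  by (induction a) (simp_all add: hom_coeff_add)

lemma D_free_pow_scal: "(D_free i ^^ a) (scal c * x) = scal c * (D_free i ^^ a) x"
  by (induction a) (simp_all add: hom_coeff_scal)

lemma D_free_pow_D_free: "(D_free i ^^ a) (D_free j x) = D_free j ((D_free i ^^ a) x)"
  by (induction a) (simp_all add: D_free_commute)

lemma D_free_pow_D_free_pow:
  "(D_free i ^^ a) ((D_free j ^^ b) x) = (D_free j ^^ b) ((D_free i ^^ a) x)"
  by (induction b) (simp_all add: D_free_pow_D_free)

lemma D_monomial_add: "D_monomial k m (x + y) = D_monomial k m x + D_monomial k m y"
  by (induction k) (simp_all add: D_free_pow_add)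

lemma D_monomial_scal: "D_monomial k m (scal c * x) = scal c * D_monomial k m x"
  by (induction k) (simp_all add: D_free_pow_scal)

lemma D_monomial_D_free: "D_monomial k m (D_free j x) = D_free j (D_monomial k m x)"
  by (induction k) (simp_all add: D_free_pow_D_free)

lemma D_monomial_D_free_pow:
  "D_monomial k m ((D_free j ^^ a) x) = (D_free j ^^ a) (D_monomial k m x)"
  by (induction a) (simp_all add: D_monomial_D_free)

lemma D_monomial_zero: "D_monomial k 0 x = x"
  by (induction k) simp_all

lemma D_monomial_plus: "D_monomial k (m + m') x = D_monomial k m (D_monomial k m' x)"
  by (induction k arbitrary: x) (simp_all add: lookup_add funpow_add D_monomial_D_free_pow D_free_pow_D_free_pow)

lemma D_monomial_single:
  "D_monomial k (Poly_Mapping.single i 1) x = (if i \<in> {1..k} then D_free i x else x)"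
proof -
  have "D_monomial k (Poly_Mapping.single i 1) x = (if i \<in> {1..k} then D_free i x else x)" if "i > k \<or> i \<le> k"
    by (induction k) (auto simp: lookup_single when_def)
  then show ?thesis by linarith
qed

lemma D_monomial_homogeneous:
  "x \<in> homogeneous k' \<Longrightarrow> D_monomial k m x \<in> homogeneous k'"
proof (induction k)
  case (Suc k)
  have "y \<in> homogeneous k' \<Longrightarrow> (D_free i ^^ a) y \<in> homogeneous k'" for y :: "(_, 'a) free_alg" and i a
    by (induction a) (simp_all add: homogeneous_D_free)
  with Suc show ?case by simp
qed simp

lemma D_monomial_ext_ideal:
  "x \<in> ext_ideal (act n) \<Longrightarrow> D_monomial k m x \<in> ext_ideal (act n)"
proof (induction k)
  case (Suc k)
  have "y \<in> ext_ideal (act n) \<Longrightarrow> (D_free i ^^ a) y \<in> ext_ideal (act n)" for y i a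
    by (induction a) (simp_all add: D_free_ext_ideal)
  with Suc show ?case by simp
qed simp

definition poly_op ::
  "nat \<Rightarrow> mpoly_q \<Rightarrow> (nat \<Rightarrow>\<^sub>0 int, int poly) free_alg \<Rightarrow> (nat \<Rightarrow>\<^sub>0 int, int poly) free_alg"
  where "poly_op k p x = lin_ext (\<lambda>m c. scal c * D_monomial k m x) p"

lemma additive_poly_op: "Modules.additive (\<lambda>p. poly_op k p x)"
  unfolding poly_op_def
  by (rule lin_ext_additive) (simp add: additive_def scal_add distrib_right)

lemmas poly_op_plus = additive.add[OF additive_poly_op]
lemmas poly_op_minus = additive.minus[OF additive_poly_op]
lemmas poly_op_diff = additive.diff[OF additive_poly_op]
lemmas poly_op_sum = additive.sum[OF additive_poly_op]

lemma poly_op_single: "poly_op k (Poly_Mapping.single m c) x = scal c * D_monomial k m x"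
  by (simp add: poly_op_def lin_ext_single)

lemma poly_op_const: "poly_op k (const c) x = scal c * x"
  by (simp add: const_def poly_op_single D_monomial_zero)

lemma poly_op_indet: "i \<in> {1..k} \<Longrightarrow> poly_op k (indet i) x = D_free i x"
  unfolding indet_def poly_op_single D_monomial_single by simp

lemma poly_op_1: "poly_op k 1 x = x"
  using poly_op_const[of k 1] by simp

lemma poly_op_add: "poly_op k p (x + y) = poly_op k p x + poly_op k p y"
  by (simp add: poly_op_def lin_ext_def D_monomial_add distrib_left sum.distrib)

lemma poly_op_scal: "poly_op k p (scal c * x) = scal c * poly_op k p x"
proof -
  have "scal d * (scal c * y) = scal c * (scal d * y)" for d and y :: "(nat \<Rightarrow>\<^sub>0 int, int poly) free_alg"
    by (metis mult.assoc scal_central)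
  then show ?thesis
    by (simp add: poly_op_def lin_ext_def D_monomial_scal sum_distrib_left)
qed

lemma poly_op_D_free: "poly_op k p (D_free j x) = D_free j (poly_op k p x)"
  by (simp add: poly_op_def lin_ext_def D_monomial_D_free hom_coeff_sum hom_coeff_scal)

lemma poly_op_mult: "poly_op k (p * q) x = poly_op k p (poly_op k q x)"
proof (induction p rule: poly_mapping_add_induct)
  case (1 m c)
  show ?case
  proof (induction q rule: poly_mapping_add_induct)
    case (1 m' d)
    show ?case
      by (simp add: mult_single poly_op_single D_monomial_plus D_monomial_scal scal_mult mult.assoc)
  qed (simp add: distrib_left poly_op_plus poly_op_add)
qed (simp add: distrib_right poly_op_plus)

lemma poly_op_homogeneous:
  "x \<in> homogeneous l \<Longrightarrow> poly_op k p x \<in> homogeneous l"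
  by (simp add: poly_op_def lin_ext_def homogeneous_sum homogeneous_scal_mult D_monomial_homogeneous)

lemma poly_op_ext_ideal:
  "x \<in> ext_ideal (act n) \<Longrightarrow> poly_op k p x \<in> ext_ideal (act n)"
  by (simp add: poly_op_def lin_ext_def ext_ideal_sum ext_ideal_mult_left D_monomial_ext_ideal)

text \<open>
  Both sides satisfy the recursion for the coefficients of an inverse series. The bound
  \<open>j \<le> k\<close> ensures that the indeterminates in \<open>a\<^sub>j\<close> are among those that act.
\<close>

lemma poly_op_inv_coeff: "j \<le> k \<Longrightarrow> poly_op k (inv_coeff j) x = D_free_inv j x"
proof (induction j arbitrary: x rule: less_induct)
  case (less j)
  show ?case
  proof (cases "j = 0")
    case False
    have "poly_op k (indet i * inv_coeff (j - i)) x = D_free_inv (j - i) (D_free i x)" if "i \<in> {1..j}" for i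
      using that less by (subst mult.commute) (simp add: poly_op_mult poly_op_indet)
    with False show ?thesis
      by (subst inv_coeff_rec, simp, subst D_free_inv_rec, simp) (simp add: poly_op_minus poly_op_sum)
  qed (simp add: poly_op_1 D_free_inv_0)
qed

text \<open>
  For \<open>h > k\<close>, the inverse series on words of length \<open>k\<close> has no coefficients beyond the
  \<open>k\<close>-th, and the vanishing of the coefficient of \<open>t\<^sup>h\<close> in its product with \<open>D\<^sub>t\<close> is the
  recursion for \<open>D\<^sub>h\<close>.
\<close>

lemma poly_op_D_poly:
  assumes "x \<in> homogeneous k"
  shows "poly_op k (D_poly k h) x = D_free h x"
proof (induction h rule: less_induct)
  case (less h)
  consider "h = 0" | "h \<in> {1..k}" | "h > k" by fastforce
  then show ?case
  proof cases
    case 3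
    have "0 = (\<Sum>j=0..h. D_free_inv j (D_free (h - j) x))"
      using D_free_left_inverse[of h x] 3 by simp
    also have "\<dots> = D_free h x + (\<Sum>j=1..h. D_free_inv j (D_free (h - j) x))"
      by (simp add: sum.atLeast_Suc_atMost D_free_inv_0)
    also have "(\<Sum>j=1..h. D_free_inv j (D_free (h - j) x)) = (\<Sum>j=1..k. D_free_inv j (D_free (h - j) x))"
      using 3 D_free_inv_vanish[OF homogeneous_D_free[OF assms]] by (intro sum.mono_neutral_right) auto
    also have "\<dots> = (\<Sum>j=1..k. poly_op k (inv_coeff j * D_poly k (h - j)) x)"
      using 3 less by (intro sum.cong) (auto simp: poly_op_mult poly_op_inv_coeff)
    finally have "D_free h x = - (\<Sum>j=1..k. poly_op k (inv_coeff j * D_poly k (h - j)) x)"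
      by (simp add: eq_neg_iff_add_eq_0)
    with 3 show ?thesis
      by (subst D_poly.simps) (simp add: poly_op_minus poly_op_sum)
  qed (simp_all add: D_poly.simps poly_op_1 D_free_0 poly_op_indet)
qed

section \<open>The ideal of the presentation\<close>

lemma poly_ring_sel [simp]:
  "carrier (poly_ring k) = polys k" "x \<otimes>\<^bsub>poly_ring k\<^esub> y = x * y" "x \<oplus>\<^bsub>poly_ring k\<^esub> y = x + y"
  "\<one>\<^bsub>poly_ring k\<^esub> = 1" "\<zero>\<^bsub>poly_ring k\<^esub> = 0"
  by (simp_all add: poly_ring_def polys_def ring_of_type_algebra_def)

lemma cring_poly_ring: "cring (poly_ring k)"
proof -
  have "\<exists>y\<in>polys k. y + x = 0" if "x \<in> polys k" for x
    using that polys_minus[of x k] by force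
  then have "abelian_group (poly_ring k)"
    by (intro abelian_groupI) (auto simp: polys_add algebra_simps)
  moreover have "comm_monoid (poly_ring k)"
    by (rule comm_monoidI) (auto simp: polys_mult algebra_simps)
  ultimately show ?thesis
    by (intro cringI) (auto simp: algebra_simps)
qed

lemma ring_poly_ring: "ring (poly_ring k)"
  by (rule cring.axioms(1)[OF cring_poly_ring])

abbreviation pres_gens :: "nat \<Rightarrow> nat \<Rightarrow> mpoly_q set"
  where "pres_gens k n \<equiv> D_poly k ` {n - k + 1..n - 1} \<union> {D_poly k n - const [:0, 1:]}"

lemma pres_gens_polys: "pres_gens k n \<subseteq> polys k"
  by (auto intro: D_poly_polys polys_diff)

lemma ideal_pres_ideal: "ideal (pres_ideal k n) (poly_ring k)"
  unfolding pres_ideal_def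
  by (rule ring.genideal_ideal[OF ring_poly_ring]) (use pres_gens_polys in simp)

lemma pres_ideal_subset: "p \<in> pres_ideal k n \<Longrightarrow> p \<in> polys k"
  using additive_subgroup.a_Hcarr[OF ideal.axioms(1)[OF ideal_pres_ideal]] by simp

lemma pres_ideal_0 [simp]: "0 \<in> pres_ideal k n"
  and pres_ideal_add: "p \<in> pres_ideal k n \<Longrightarrow> q \<in> pres_ideal k n \<Longrightarrow> p + q \<in> pres_ideal k n"
  and pres_ideal_mult: "p \<in> pres_ideal k n \<Longrightarrow> u \<in> polys k \<Longrightarrow> u * p \<in> pres_ideal k n"
  using additive_subgroup.zero_closed[OF ideal.axioms(1)[OF ideal_pres_ideal[of k n]]]
    additive_subgroup.a_closed[OF ideal.axioms(1)[OF ideal_pres_ideal[of k n]], of p q]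
    ideal.I_l_closed[OF ideal_pres_ideal[of k n], of p u]
  by simp_all

lemma pres_ideal_minus: "p \<in> pres_ideal k n \<Longrightarrow> - p \<in> pres_ideal k n"
  using pres_ideal_mult[of p k n "- 1"] polys_minus[OF polys_1, of k] by simp

lemma pres_ideal_diff:
  "p \<in> pres_ideal k n \<Longrightarrow> q \<in> pres_ideal k n \<Longrightarrow> p - q \<in> pres_ideal k n"
  using pres_ideal_add[OF _ pres_ideal_minus, of p k n q] by simp

lemma pres_ideal_sum:
  "(\<And>i. i \<in> A \<Longrightarrow> f i \<in> pres_ideal k n) \<Longrightarrow> sum f A \<in> pres_ideal k n"
  by (induction A rule: infinite_finite_induct) (auto intro: pres_ideal_add)

lemma pres_ideal_trans:
  "p - q \<in> pres_ideal k n \<Longrightarrow> q - r \<in> pres_ideal k n \<Longrightarrow> p - r \<in> pres_ideal k n"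
  using pres_ideal_add[of "p - q" k n "q - r"] by simp

lemma pres_ideal_gens: "p \<in> pres_gens k n \<Longrightarrow> p \<in> pres_ideal k n"
  unfolding pres_ideal_def
  using ring.genideal_self[OF ring_poly_ring, of "pres_gens k n" k] pres_gens_polys by auto

text \<open>
  Modulo the ideal, the \<open>k\<close> consecutive terms \<open>D\<^sub>n\<^sub>-\<^sub>k\<^sub>+\<^sub>1, \<dots>, D\<^sub>n\<close> are \<open>q\<close> times the \<open>k\<close>
  consecutive terms \<open>D\<^sub>1\<^sub>-\<^sub>k, \<dots>, D\<^sub>0\<close>, that is, \<open>0, \<dots>, 0, q\<close>; this is what the generators of the
  ideal say. The linear recursion of length \<open>k\<close> propagates the proportionality to all later
  terms.
\<close>

lemma D_int_periodic:
  assumes "k \<le> n" "h > - int k"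
  shows "D_int k (h + int n) - const [:0, 1:] * D_int k h \<in> pres_ideal k n"
  using assms(2)
proof (induction "nat (h + int k)" arbitrary: h rule: less_induct)
  case less
  consider "h < 0" | "h = 0" | "h \<ge> 1" by linarith
  then show ?case
  proof cases
    case 1
    then have "nat (h + int n) \<in> {n - k + 1..n - 1}"
      using less.prems assms(1) by auto
    then have "D_poly k (nat (h + int n)) \<in> pres_ideal k n"
      by (intro pres_ideal_gens) blast
    moreover have "h + int n \<ge> 0" using less.prems assms(1) by linarith
    ultimately show ?thesis using 1 by (simp add: D_int_def)
  next
    case 2
    have "D_poly k n - const [:0, 1:] \<in> pres_ideal k n"
      by (rule pres_ideal_gens) simp
    with 2 show ?thesis by (simp add: D_int_def D_poly.simps[of k 0])
  next
    case 3
    have IH: "inv_coeff j * (D_int k (h - int j + int n) - const [:0, 1:] * D_int k (h - int j)) \<in> pres_ideal k n"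
      if "j \<in> {1..k}" for j
      using that 3 inv_coeff_polys[of j] polys_mono[of j k]
      by (intro pres_ideal_mult less.hyps) auto
    have "D_int k (h + int n) - const [:0, 1:] * D_int k h =
        - (\<Sum>j=1..k. inv_coeff j * (D_int k (h - int j + int n) - const [:0, 1:] * D_int k (h - int j)))"
      using 3 by (simp add: D_int_rec[of "h + int n"] D_int_rec[of h] sum_distrib_left sum_subtractf
          algebra_simps)
    also have "\<dots> \<in> pres_ideal k n"
      by (intro pres_ideal_minus pres_ideal_sum IH)
    finally show ?thesis .
  qed
qed

section \<open>Rows of Giambelli determinants\<close>

text \<open>
  The additive extension of \<open>\<epsilon>\<^sup>i \<mapsto> (D\<^sub>i\<^sub>-\<^sub>1, \<dots>, D\<^sub>i\<^sub>-\<^sub>k)\<close>; here both the index of \<open>\<epsilon>\<close> and the column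
  \<open>b\<close> are counted from zero.
\<close>

definition row_entry ::
  "nat \<Rightarrow> (nat \<Rightarrow>\<^sub>0 int) \<Rightarrow> nat \<Rightarrow> mpoly_q"
  where "row_entry k x b = lin_ext (\<lambda>i c. of_int c * D_int k (int i - int b)) x"

lemma additive_row_entry: "Modules.additive (\<lambda>x. row_entry k x b)"
  unfolding row_entry_def by (rule lin_ext_additive) (simp add: additive_def distrib_right)

lemmas row_entry_add = additive.add[OF additive_row_entry]
lemmas row_entry_sum = additive.sum[OF additive_row_entry]

lemma row_entry_single:
  "row_entry k (Poly_Mapping.single i c) b = of_int c * D_int k (int i - int b)"
  by (simp add: row_entry_def lin_ext_single)

lemma const_of_int: "const (of_int c) = of_int c"
  by (simp add: const_def)

lemma row_entry_polys: "row_entry k x b \<in> polys k"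
  unfolding row_entry_def lin_ext_def
  by (intro polys_sum polys_mult D_int_polys) (simp flip: const_of_int)

lemma row_entry_scale: "row_entry k (Poly_Mapping.map ((*) c) x) b = of_int c * row_entry k x b"
  by (induction x rule: poly_mapping_add_induct)
    (simp_all add: row_entry_single map_mult_add row_entry_add distrib_left)

lemma row_entry_shift_n:
  assumes "k \<le> n" "b < k"
  shows "row_entry k (shift n x) b - const [:0, 1:] * row_entry k x b \<in> pres_ideal k n"
proof (induction x rule: poly_mapping_add_induct)
  case (1 i c)
  have "const (of_int c) * (D_int k (int i - int b + int n) - const [:0, 1:] * D_int k (int i - int b)) \<in> pres_ideal k n"
    using assms by (intro pres_ideal_mult D_int_periodic) auto
  then show ?case by (simp add: row_entry_single const_of_int algebra_simps)
next
  case (2 x y)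
  then show ?case
    using pres_ideal_add[OF 2] by (simp add: shift_add row_entry_add algebra_simps)
qed

lemma row_entry_shift_power:
  assumes "k \<le> n" "b < k"
  shows "row_entry k ((shift n ^^ i) x) b - const ([:0, 1:] ^ i) * row_entry k x b \<in> pres_ideal k n"
proof (induction i)
  case (Suc i)
  have "const [:0, 1:] * (row_entry k ((shift n ^^ i) x) b - const ([:0, 1:] ^ i) * row_entry k x b) \<in> pres_ideal k n"
    by (intro pres_ideal_mult Suc polys_const)
  with row_entry_shift_n[OF assms, of "(shift n ^^ i) x"]
  have "row_entry k (shift n ((shift n ^^ i) x)) b - const [:0, 1:] * (const ([:0, 1:] ^ i) * row_entry k x b)
      \<in> pres_ideal k n"
    unfolding right_diff_distrib by (rule pres_ideal_trans)
  then show ?case by (simp only: funpow.simps comp_apply power_Suc const_mult mult.assoc)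
qed simp

lemma const_sum: "const (sum f A) = (\<Sum>i\<in>A. const (f i))"
  by (induction A rule: infinite_finite_induct) (simp_all add: const_add)

text \<open>
  Rows are \<open>\<int>[q]\<close>-linear modulo the ideal, since \<open>q\<close> acts on \<open>M\<close> as the shift by \<open>n\<close> and on
  the \<open>D\<^sub>h\<close> as the shift of the index by \<open>n\<close>.
\<close>

lemma row_entry_act:
  assumes "k \<le> n" "b < k"
  shows "row_entry k (act n c x) b - const c * row_entry k x b \<in> pres_ideal k n"
proof -
  have "c = (\<Sum>i\<le>degree c. of_int (coeff c i) * [:0, 1:] ^ i)"
    by (subst poly_as_sum_of_monoms[symmetric]) (simp add: monom_altdef of_int_poly)
  then have "const c = const (\<Sum>i\<le>degree c. of_int (coeff c i) * [:0, 1:] ^ i)"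
    by (rule arg_cong)
  also have "\<dots> = (\<Sum>i\<le>degree c. of_int (coeff c i) * const ([:0, 1:] ^ i))"
    by (simp only: const_sum const_mult const_of_int)
  finally have c: "const c = (\<Sum>i\<le>degree c. of_int (coeff c i) * const ([:0, 1:] ^ i))" .
  have "row_entry k (act n c x) b - const c * row_entry k x b =
     (\<Sum>i\<le>degree c. const (of_int (coeff c i)) *
        (row_entry k ((shift n ^^ i) x) b - const ([:0, 1:] ^ i) * row_entry k x b))"
    unfolding c
    by (simp add: act_def row_entry_sum row_entry_scale const_of_int sum_distrib_right right_diff_distrib
        mult.assoc flip: sum_subtractf)
  also have "\<dots> \<in> pres_ideal k n"
    by (intro pres_ideal_sum pres_ideal_mult row_entry_shift_power assms polys_const)
  finally show ?thesis .
qed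

text \<open>
  The companion matrix of the recursion for the \<open>D\<^sub>h\<close>, in the convention that it acts on rows
  from the right and increases all indices of the row by one.
\<close>

definition companion :: "nat \<Rightarrow> nat \<Rightarrow> mpoly_q"
  where "companion c b = (if b = 0 then - inv_coeff (Suc c) else if Suc c = b then 1 else 0)"

lemma row_entry_shift_1:
  assumes "b < k"
  shows "row_entry k (shift 1 x) b = (\<Sum>c=0..<k. row_entry k x c * companion c b)"
proof (induction x rule: poly_mapping_add_induct)
  case (1 i d)
  have "D_int k (int (Suc i) - int b) = (\<Sum>c=0..<k. D_int k (int i - int c) * companion c b)"
  proof (cases b)
    case 0
    have "D_int k (int (Suc i) - int b) = - (\<Sum>j=1..k. inv_coeff j * D_int k (int (Suc i) - int j))"
      using 0 by (simp add: D_int_rec)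
    also have "(\<Sum>j=1..k. inv_coeff j * D_int k (int (Suc i) - int j))
        = (\<Sum>c=0..<k. inv_coeff (Suc c) * D_int k (int i - int c))"
      by (rule sum.reindex_bij_witness[where i = Suc and j = "\<lambda>j. j - 1"])
        (auto simp: algebra_simps of_nat_diff)
    finally show ?thesis
      using 0 by (simp add: companion_def mult.commute sum_negf)
  next
    case (Suc b')
    have "(\<Sum>c=0..<k. D_int k (int i - int c) * companion c b) = (\<Sum>c=0..<k. if c = b' then D_int k (int i - int b') else 0)"
      by (intro sum.cong) (auto simp: companion_def Suc)
    also have "\<dots> = D_int k (int i - int b')" using assms Suc by simp
    finally show ?thesis using Suc by simp
  qed
  then show ?case by (simp add: row_entry_single sum_distrib_left mult.assoc)
qed (simp add: shift_add row_entry_add distrib_right sum.distrib)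

section \<open>Giambelli's map\<close>

definition row_det :: "nat \<Rightarrow> (nat \<Rightarrow>\<^sub>0 int) list \<Rightarrow> mpoly_q"
  where "row_det k ws =
    (if length ws = k then det (mat k k (\<lambda>(a, b). row_entry k (ws ! a) b)) else 0)"

definition giambelli ::
  "nat \<Rightarrow> (nat \<Rightarrow>\<^sub>0 int, int poly) free_alg \<Rightarrow> mpoly_q"
  where "giambelli k = lin_ext (\<lambda>w c. const c * row_det k (letters w))"

lemma additive_giambelli: "Modules.additive (giambelli k)"
  unfolding giambelli_def
  by (rule lin_ext_additive) (simp add: additive_def const_add distrib_right)

lemmas giambelli_add = additive.add[OF additive_giambelli]
lemmas giambelli_diff = additive.diff[OF additive_giambelli]

lemma giambelli_word: "giambelli k (scal c * tensor ws) = const c * row_det k ws"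
  by (simp add: giambelli_def scal_mult_tensor lin_ext_single)

lemma giambelli_tensor: "giambelli k (tensor ws) = row_det k ws"
  using giambelli_word[of k 1] by simp

lemma giambelli_scal: "giambelli k (scal c * p) = const c * giambelli k p"
proof (induction p rule: free_alg_induct)
  case (word d ws)
  show ?case
    by (simp add: giambelli_word const_mult mult.assoc flip: mult.assoc[of "scal c"] scal_mult)
qed (simp add: distrib_left giambelli_add)

text \<open>
  The determinant as a function of the row at position \<open>length us\<close>, the other rows being given
  by \<open>us\<close> and \<open>vs\<close>. The letter \<open>0\<close> only fills that position; the product omits it.
\<close>

definition row_expansion ::
  "nat \<Rightarrow> (nat \<Rightarrow>\<^sub>0 int) list \<Rightarrow> (nat \<Rightarrow>\<^sub>0 int) list \<Rightarrow> (nat \<Rightarrow> mpoly_q) \<Rightarrow> mpoly_q"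
  where "row_expansion k us vs f =
    (if length us + Suc (length vs) = k then
      \<Sum>\<sigma> | \<sigma> permutes {0..<k}. of_int (sign \<sigma>) * (f (\<sigma> (length us)) *
        (\<Prod>a\<in>{0..<k} - {length us}. row_entry k ((us @ 0 # vs) ! a) (\<sigma> a)))
     else 0)"

lemma row_det_row_expansion: "row_det k (us @ y # vs) = row_expansion k us vs (row_entry k y)"
proof (cases "length us + Suc (length vs) = k")
  case True
  have nth: "(us @ y # vs) ! a = (us @ 0 # vs) ! a" if "a \<noteq> length us" for a
    using that by (cases "a < length us") (auto simp: nth_append nth_Cons')
  have "(\<Prod>a=0..<k. row_entry k ((us @ y # vs) ! a) (\<sigma> a)) = row_entry k y (\<sigma> (length us)) *
      (\<Prod>a\<in>{0..<k} - {length us}. row_entry k ((us @ 0 # vs) ! a) (\<sigma> a))" for \<sigma>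
    using True
    by (subst prod.remove[of _ "length us"]) (auto intro!: prod.cong simp: nth)
  moreover have "row_det k (us @ y # vs) =
      (\<Sum>\<sigma> | \<sigma> permutes {0..<k}. of_int (sign \<sigma>) * (\<Prod>a=0..<k. row_entry k ((us @ y # vs) ! a) (\<sigma> a)))"
    using True by (auto simp: row_det_def det_def permutes_in_image intro!: sum.cong prod.cong)
  ultimately show ?thesis using True by (simp add: row_expansion_def)
qed (simp add: row_det_def row_expansion_def)

lemma row_expansion_add:
  "row_expansion k us vs (\<lambda>b. f b + g b) = row_expansion k us vs f + row_expansion k us vs g"
  by (simp add: row_expansion_def algebra_simps sum.distrib)

lemma row_expansion_diff:
  "row_expansion k us vs (\<lambda>b. f b - g b) = row_expansion k us vs f - row_expansion k us vs g"
  by (simp add: row_expansion_def algebra_simps sum_subtractf)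

lemma row_expansion_scale:
  "row_expansion k us vs (\<lambda>b. c * f b) = c * row_expansion k us vs f"
  by (simp add: row_expansion_def algebra_simps sum_distrib_left)

lemma polys_of_int: "of_int c \<in> polys k"
  by (simp flip: const_of_int)

lemma row_expansion_pres_ideal:
  assumes "\<And>b. b < k \<Longrightarrow> f b \<in> pres_ideal k n"
  shows "row_expansion k us vs f \<in> pres_ideal k n"
proof -
  have "of_int (sign \<sigma>) * (f (\<sigma> (length us)) * (\<Prod>a\<in>{0..<k} - {length us}. row_entry k ((us @ 0 # vs) ! a) (\<sigma> a)))
      \<in> pres_ideal k n" if "\<sigma> permutes {0..<k}" "length us < k" for \<sigma>
  proof -
    have "\<sigma> (length us) < k"
      using permutes_in_image[OF that(1), of "length us"] that(2) by simp
    then show ?thesis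
      by (subst mult.commute[of "f _"]) (intro pres_ideal_mult polys_of_int polys_prod row_entry_polys assms)
  qed
  then show ?thesis
    by (auto simp: row_expansion_def intro!: pres_ideal_sum)
qed

lemma row_det_polys: "row_det k ws \<in> polys k"
proof -
  have "of_int (sign \<sigma>) * (\<Prod>a=0..<k. mat k k (\<lambda>(a, b). row_entry k (ws ! a) b) $$ (a, \<sigma> a)) \<in> polys k"
    if "\<sigma> permutes {0..<k}" for \<sigma>
    using permutes_in_image[OF that]
    by (intro polys_mult polys_of_int polys_prod) (auto simp: row_entry_polys)
  then show ?thesis
    by (auto simp: row_det_def det_def intro!: polys_sum)
qed

lemma giambelli_polys: "giambelli k p \<in> polys k"
  by (simp add: giambelli_def lin_ext_def polys_sum polys_mult row_det_polys)

lemma row_det_repeat: "row_det k (us @ x # x # vs) = 0"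
proof (cases "length (us @ x # x # vs) = k")
  case True
  show ?thesis
    unfolding row_det_def if_P[OF True]
    by (rule det_identical_rows[where n = k and i = "length us" and j = "Suc (length us)"])
      (use True in \<open>auto simp: nth_append intro!: eq_vecI\<close>)
qed (simp only: row_det_def if_False)

text \<open>
  The determinants are alternating, and by the linearity of the rows they are
  \<open>\<int>[q]\<close>-multilinear modulo the ideal of the presentation.
\<close>

lemma giambelli_ext_ideal:
  assumes "k \<le> n" "p \<in> ext_ideal (act n)"
  shows "giambelli k p \<in> pres_ideal k n"
  using assms(2)
proof (induction rule: ext_ideal_induct)
  case (rel r u v)
  have w: "giambelli k (tensor us * r * tensor vs) \<in> pres_ideal k n" for us vs
  proof -
    have g: "tensor us * gen y * tensor vs = tensor (us @ y # vs)" for y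
      by (simp add: tensor_append tensor_Cons mult.assoc)
    have T: "giambelli k (tensor us * gen y * tensor vs) = row_expansion k us vs (row_entry k y)" for y
      unfolding g giambelli_tensor row_det_row_expansion ..
    consider x y where "r = gen (x + y) - (gen x + gen y)"
      | c x where "r = gen (act n c x) - scal c * gen x" | x where "r = gen x * gen x"
      using rel unfolding ext_relations_def by blast
    then show ?thesis
    proof cases
      case 1
      have "row_entry k (x + y) = (\<lambda>b. row_entry k x b + row_entry k y b)"
        by (rule ext) (rule row_entry_add)
      then have "giambelli k (tensor us * r * tensor vs) = 0"
        unfolding 1 by (simp add: left_diff_distrib right_diff_distrib distrib_left distrib_right
            giambelli_diff giambelli_add T row_expansion_add)
      then show ?thesis by simp
    next
      case 2
      have "tensor us * r * tensor vs = tensor us * gen (act n c x) * tensor vs - scal c * (tensor us * gen x * tensor vs)"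
        unfolding 2 by (simp add: left_diff_distrib right_diff_distrib scal_central[of "tensor us"]
            flip: mult.assoc)
      then have "giambelli k (tensor us * r * tensor vs)
          = row_expansion k us vs (\<lambda>b. row_entry k (act n c x) b - const c * row_entry k x b)"
        by (simp only: giambelli_diff giambelli_scal T row_expansion_diff row_expansion_scale)
      also have "\<dots> \<in> pres_ideal k n"
        by (intro row_expansion_pres_ideal row_entry_act assms)
      finally show ?thesis .
    next
      case 3
      have "tensor us * r * tensor vs = tensor (us @ x # x # vs)"
        unfolding 3 by (simp add: tensor_append tensor_Cons mult.assoc)
      then show ?thesis by (simp only: giambelli_tensor row_det_repeat pres_ideal_0)
    qed
  qed
  show ?case
  proof (induction u rule: free_alg_induct)
    case (word c us)
    show ?case
    proof (induction v rule: free_alg_induct)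
      case (word d vs)
      have "scal c * tensor us * r * (scal d * tensor vs) = scal c * (tensor us * r * scal d) * tensor vs"
        by (simp only: mult.assoc)
      also have "\<dots> = scal c * (scal d * (tensor us * r * tensor vs))"
        unfolding scal_central[of "tensor us * r" d] by (simp only: mult.assoc)
      finally have "scal c * tensor us * r * (scal d * tensor vs) = scal c * (scal d * (tensor us * r * tensor vs))" .
      then show ?case by (simp add: giambelli_scal pres_ideal_mult w)
    qed (simp add: distrib_left giambelli_add pres_ideal_add)
  qed (simp add: distrib_right giambelli_add pres_ideal_add)
qed (simp add: giambelli_add pres_ideal_add)

section \<open>Giambelli's map and the operators\<close>

text \<open>
  The product of one additive functional per letter. By the Leibniz formula, Giambelli's map
  is a signed sum of such products; for each of them, applying \<open>D\<^sub>t\<close> to a word just multiplies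
  power series.
\<close>

primrec tensor_eval :: "((nat \<Rightarrow>\<^sub>0 int) \<Rightarrow> mpoly_q) list \<Rightarrow> (nat \<Rightarrow>\<^sub>0 int) list \<Rightarrow> mpoly_q"
  where "tensor_eval [] ws = (if ws = [] then 1 else 0)"
  | "tensor_eval (l # ls) ws = (case ws of [] \<Rightarrow> 0 | x # xs \<Rightarrow> l x * tensor_eval ls xs)"

lemma tensor_eval_eq:
  "tensor_eval ls ws = (if length ws = length ls then \<Prod>a=0..<length ls. (ls ! a) (ws ! a) else 0)"
  by (induction ls arbitrary: ws)
    (auto simp: prod.atLeast0_lessThan_Suc_shift split: list.splits simp del: prod.op_ivl_Suc)

definition tensor_functional ::
  "((nat \<Rightarrow>\<^sub>0 int) \<Rightarrow> mpoly_q) list \<Rightarrow> (nat \<Rightarrow>\<^sub>0 int, int poly) free_alg \<Rightarrow> mpoly_q"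
  where "tensor_functional ls = lin_ext (\<lambda>w c. const c * tensor_eval ls (letters w))"

lemma additive_tensor_functional: "Modules.additive (tensor_functional ls)"
  unfolding tensor_functional_def
  by (rule lin_ext_additive) (simp add: additive_def const_add distrib_right)

lemmas tensor_functional_add = additive.add[OF additive_tensor_functional]
lemmas tensor_functional_sum = additive.sum[OF additive_tensor_functional]
lemmas tensor_functional_0 = additive.zero[OF additive_tensor_functional]

lemma tensor_functional_word:
  "tensor_functional ls (scal c * tensor ws) = const c * tensor_eval ls ws"
  by (simp add: tensor_functional_def scal_mult_tensor lin_ext_single)

lemma tensor_functional_gen_mult:
  "tensor_functional (l # ls) (gen y * p) = l y * tensor_functional ls p"
proof (induction p rule: free_alg_induct)
  case (word c ws)
  have "gen y * (scal c * tensor ws) = scal c * tensor (y # ws)"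
    by (simp add: tensor_Cons scal_central flip: mult.assoc)
  then show ?case by (simp add: tensor_functional_word mult.left_commute)
qed (simp add: distrib_left tensor_functional_add)

lemma tensor_functional_D_free:
  "length ws = length ls \<Longrightarrow>
    tensor_functional ls (D_free j (tensor ws)) = fps_nth (\<Prod>a=0..<length ls. Abs_fps (\<lambda>j. (ls ! a) (shift j (ws ! a)))) j"
proof (induction ls arbitrary: ws j)
  case Nil
  then show ?case using tensor_functional_word[of "[]" 1 "[]"] by (simp add: hom_coeff_one tensor_functional_0)
next
  case (Cons l ls)
  then obtain x xs where ws: "ws = x # xs" "length xs = length ls" by (cases ws) auto
  have "tensor_functional (l # ls) (D_free j (tensor ws)) = (\<Sum>a=0..j. l (shift a x) * tensor_functional ls (D_free (j - a) (tensor xs)))"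
    by (simp add: ws tensor_Cons D_free_gen_mult tensor_functional_sum tensor_functional_gen_mult)
  also have "\<dots> = fps_nth (Abs_fps (\<lambda>j. l (shift j x)) *
      (\<Prod>a=0..<length ls. Abs_fps (\<lambda>j. (ls ! a) (shift j (xs ! a))))) j"
    by (simp add: fps_mult_nth Cons.IH ws)
  finally show ?case
    by (simp add: ws prod.atLeast0_lessThan_Suc_shift del: prod.op_ivl_Suc)
qed

lemma giambelli_expand:
  "giambelli k p = (\<Sum>\<sigma> | \<sigma> permutes {0..<k}.
    of_int (sign \<sigma>) * tensor_functional (map (\<lambda>a x. row_entry k x (\<sigma> a)) [0..<k]) p)"
proof (induction p rule: free_alg_induct)
  case (word c ws)
  have "row_det k ws = (\<Sum>\<sigma> | \<sigma> permutes {0..<k}.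
    of_int (sign \<sigma>) * tensor_eval (map (\<lambda>a x. row_entry k x (\<sigma> a)) [0..<k]) ws)"
    by (auto simp: row_det_def det_def tensor_eval_eq permutes_in_image intro!: sum.cong prod.cong)
  then show ?case
    by (simp add: giambelli_word tensor_functional_word sum_distrib_left mult.left_commute)
qed (simp add: giambelli_add tensor_functional_add distrib_left sum.distrib)

text \<open>
  The matrix of a word whose letters have been replaced by their images under \<open>D\<^sub>t\<close>.
\<close>

definition row_series ::
  "nat \<Rightarrow> (nat \<Rightarrow>\<^sub>0 int) list \<Rightarrow> mpoly_q fps mat"
  where "row_series k ws = mat k k (\<lambda>(a, b). Abs_fps (\<lambda>j. row_entry k (shift j (ws ! a)) b))"

lemma fps_of_int_mult_nth: "fps_nth (of_int z * F) j = of_int z * fps_nth F j"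
  by (simp flip: fps_of_int)

lemma giambelli_D_free_series:
  assumes "length ws = k"
  shows "giambelli k (D_free j (tensor ws)) = fps_nth (det (row_series k ws)) j"
proof -
  have "fps_nth (det (row_series k ws)) j = (\<Sum>\<sigma> | \<sigma> permutes {0..<k}. of_int (sign \<sigma>) *
      fps_nth (\<Prod>a=0..<k. row_series k ws $$ (a, \<sigma> a)) j)"
    by (simp add: det_def row_series_def fps_sum_nth fps_of_int_mult_nth)
  also have "\<dots> = (\<Sum>\<sigma> | \<sigma> permutes {0..<k}. of_int (sign \<sigma>) *
      tensor_functional (map (\<lambda>a x. row_entry k x (\<sigma> a)) [0..<k]) (D_free j (tensor ws)))"
  proof (intro sum.cong refl)
    fix \<sigma> assume "\<sigma> \<in> {\<sigma>. \<sigma> permutes {0..<k}}"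
    then have "(\<Prod>a=0..<k. row_series k ws $$ (a, \<sigma> a)) =
       (\<Prod>a=0..<k. Abs_fps (\<lambda>j. row_entry k (shift j (ws ! a)) (\<sigma> a)))"
      by (intro prod.cong) (auto simp: row_series_def permutes_in_image)
    also have "fps_nth \<dots> j = tensor_functional (map (\<lambda>a x. row_entry k x (\<sigma> a)) [0..<k]) (D_free j (tensor ws))"
      using assms by (subst tensor_functional_D_free) (auto intro!: arg_cong[where f = "\<lambda>F. fps_nth F j"] prod.cong)
    finally show "of_int (sign \<sigma>) * fps_nth (\<Prod>a=0..<k. row_series k ws $$ (a, \<sigma> a)) j =
      of_int (sign \<sigma>) * tensor_functional (map (\<lambda>a x. row_entry k x (\<sigma> a)) [0..<k]) (D_free j (tensor ws))" by simp
  qed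
  finally show ?thesis by (simp add: giambelli_expand)
qed

text \<open>
  As \<open>D\<^sub>j\<close> changes a row \<open>v\<close> to \<open>v X\<^sup>j\<close> with the companion matrix \<open>X\<close>, the matrix of \<open>D\<^sub>t\<close> of a
  word is the matrix of the word times \<open>(1 - t X)\<^sup>-\<^sup>1\<close>. The point is that \<open>B k = 1 - t X\<close> does
  not depend on the word.
\<close>

lemma row_series_factor:
  defines "B k \<equiv> mat k k (\<lambda>(c, b). (if c = b then 1 else 0) - fps_X * fps_const (companion c b))"
  assumes "length ws = k"
  shows "det (row_series k ws) * det (B k) = fps_const (row_det k ws)"
proof -
  have entry: "(\<Sum>c=0..<k. Abs_fps (\<lambda>j. row_entry k (shift j y) c) *
      ((if c = b then 1 else 0) - fps_X * fps_const (companion c b))) = fps_const (row_entry k y b)"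
    if "b < k" for y b
  proof (rule fps_ext)
    fix j
    have "fps_nth (Abs_fps (\<lambda>j. row_entry k (shift j y) c) *
        ((if c = b then 1 else 0) - fps_X * fps_const (companion c b))) j =
        (if c = b then row_entry k (shift j y) b else 0)
        - (if j = 0 then 0 else row_entry k (shift (j - 1) y) c * companion c b)" for c
      by (simp add: right_diff_distrib mult.left_commute[of _ fps_X])
    then have "fps_nth (\<Sum>c=0..<k. Abs_fps (\<lambda>j. row_entry k (shift j y) c) *
        ((if c = b then 1 else 0) - fps_X * fps_const (companion c b))) j =
      (\<Sum>c=0..<k. if c = b then row_entry k (shift j y) b else 0)
        - (\<Sum>c=0..<k. if j = 0 then 0 else row_entry k (shift (j - 1) y) c * companion c b)"
      by (simp add: fps_sum_nth sum_subtractf)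
    also have "\<dots> = row_entry k (shift j y) b - (if j = 0 then 0 else row_entry k (shift 1 (shift (j - 1) y)) b)"
      using that by (cases "j = 0") (simp_all add: row_entry_shift_1[OF that] del: One_nat_def)
    also have "\<dots> = fps_nth (fps_const (row_entry k y b)) j"
      by (simp add: shift_shift)
    finally show "fps_nth (\<Sum>c=0..<k. Abs_fps (\<lambda>j. row_entry k (shift j y) c) *
        ((if c = b then 1 else 0) - fps_X * fps_const (companion c b))) j
        = fps_nth (fps_const (row_entry k y b)) j" .
  qed
  have "row_series k ws * B k = mat k k (\<lambda>(a, b). fps_const (row_entry k (ws ! a) b))"
    by (rule eq_matI) (simp_all add: row_series_def B_def scalar_prod_def entry)
  moreover have "det (mat k k (\<lambda>(a, b). fps_const (row_entry k (ws ! a) b))) = fps_const (row_det k ws)"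
  proof -
    have hs: "fps_const (\<Sum>\<sigma>\<in>S. f \<sigma>) = (\<Sum>\<sigma>\<in>S. fps_const (f \<sigma>))" for S and f :: "_ \<Rightarrow> mpoly_q"
      by (induction S rule: infinite_finite_induct) (simp_all flip: fps_const_add)
    have hp: "fps_const (\<Prod>\<sigma>\<in>S. f \<sigma>) = (\<Prod>\<sigma>\<in>S. fps_const (f \<sigma>))" for S and f :: "_ \<Rightarrow> mpoly_q"
      by (induction S rule: infinite_finite_induct) (simp_all flip: fps_const_mult)
    show ?thesis
      using assms
      by (auto simp: row_det_def det_def hs hp permutes_in_image simp flip: fps_const_mult fps_of_int
          intro!: sum.cong prod.cong)
  qed
  ultimately show ?thesis
    using det_mult[of "row_series k ws" k "B k"] by (simp add: row_series_def B_def)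
qed

text \<open>
  The matrix is lower triangular, because \<open>D\<^sub>h = 0\<close> for \<open>h < 0\<close>; all diagonal entries but the
  last one are \<open>D\<^sub>0 = 1\<close>.
\<close>

lemma row_det_last:
  "row_det (Suc k) (map eps [0..<k] @ [eps (k + h)]) = D_poly (Suc k) h"
proof -
  let ?ws = "map eps [0..<k] @ [eps (k + h)]"
  let ?A = "mat (Suc k) (Suc k) (\<lambda>(a, b). row_entry (Suc k) (?ws ! a) b)"
  have "det ?A = prod_list (diag_mat ?A)"
    by (rule det_lower_triangular[where n = "Suc k"]) (auto simp: nth_append row_entry_single)
  also have "diag_mat ?A = map (\<lambda>a. if a < k then 1 else D_poly (Suc k) h) [0..<Suc k]"
    unfolding diag_mat_def
    by (intro map_cong) (auto simp: nth_append row_entry_single D_int_def D_poly.simps[of _ 0])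
  finally have diag: "det ?A = prod_list (map (\<lambda>a. if a < k then 1 else D_poly (Suc k) h) [0..<Suc k])" .
  have "map (\<lambda>a. if a < k then 1 else D_poly (Suc k) h) [0..<k] = map (\<lambda>_. 1) [0..<k]"
    by (intro map_cong) auto
  then have "prod_list (map (\<lambda>a. if a < k then 1 else D_poly (Suc k) h) [0..<Suc k]) = D_poly (Suc k) h"
    by (simp add: map_replicate_const)
  with diag show ?thesis by (simp add: row_det_def)
qed

lemma giambelli_m0: "0 < k \<Longrightarrow> giambelli k (m0 k) = 1"
proof (cases k)
  case (Suc l)
  then show ?thesis
    using row_det_last[of l 0] by (simp add: m0_def giambelli_tensor D_poly.simps[of _ 0])
qed simp

text \<open>
  The series \<open>det (1 - t X)\<^sup>-\<^sup>1\<close>, by which \<open>D\<^sub>t\<close> multiplies all determinants, is found by looking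
  at the word \<open>m\<^sub>0\<close>, whose determinant is \<open>1\<close>.
\<close>

lemma giambelli_D_free_eq:
  assumes "0 < k" "x \<in> homogeneous k"
  shows "giambelli k (D_free j x) = giambelli k x * giambelli k (D_free j (m0 k))"
  using assms(2)
proof (induction rule: homogeneous_induct)
  case (word c ws)
  let ?B = "det (mat k k (\<lambda>(c, b). (if c = b then 1 else 0) - fps_X * fps_const (companion c b)))"
  let ?ws0 = "map eps [0..<k]"
  have "det (row_series k ?ws0) * ?B = 1"
    using row_series_factor[of ?ws0 k] giambelli_m0[OF assms(1)] by (simp add: m0_def giambelli_tensor)
  then have "det (row_series k ws) = det (row_series k ws) * ?B * det (row_series k ?ws0)"
    by (simp add: mult.assoc mult.commute)
  also have "\<dots> = fps_const (row_det k ws) * det (row_series k ?ws0)"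
    using row_series_factor[OF word] by simp
  finally show ?case
    using word by (simp add: hom_coeff_scal giambelli_scal giambelli_tensor giambelli_D_free_series m0_def mult.assoc)
qed (simp add: hom_coeff_add giambelli_add distrib_right)

text \<open>
  It remains to evaluate Giambelli's map on \<open>D\<^sub>j m\<^sub>0\<close>, which Pieri's formula reduces to a
  triangular determinant.
\<close>

lemma giambelli_D_free:
  assumes "0 < k" "k \<le> n" "x \<in> homogeneous k"
  shows "giambelli k (D_free j x) - D_poly k j * giambelli k x \<in> pres_ideal k n"
proof -
  obtain l where k: "k = Suc l" using assms(1) by (cases k) auto
  have "giambelli k (D_free j (m0 k) - m0 l * gen (eps (l + j))) \<in> pres_ideal k n"
    using pieri[of j l "act n"] assms(2) k by (intro giambelli_ext_ideal) simp_all
  moreover have "m0 l * gen (eps (l + j)) = ( tensor (map eps [0..<l] @ [eps (l + j)]) :: (_, int poly) free_alg)"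
    by (simp add: m0_def tensor_append tensor_single)
  ultimately have "giambelli k (D_free j (m0 k)) - row_det k (map eps [0..<l] @ [eps (l + j)]) \<in> pres_ideal k n"
    by (simp only: giambelli_diff giambelli_tensor)
  then have "giambelli k (D_free j (m0 k)) - D_poly k j \<in> pres_ideal k n"
    by (simp only: k row_det_last)
  then have "giambelli k x * (giambelli k (D_free j (m0 k)) - D_poly k j) \<in> pres_ideal k n"
    by (intro pres_ideal_mult giambelli_polys)
  then show ?thesis
    by (simp add: giambelli_D_free_eq[OF assms(1,3)] algebra_simps)
qed

lemma giambelli_poly_op:
  assumes "0 < k" "k \<le> n" "x \<in> homogeneous k" "p \<in> polys k"
  shows "giambelli k (poly_op k p x) - p * giambelli k x \<in> pres_ideal k n"
  using assms(4,3)
proof (induction arbitrary: x rule: polys_induct)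
  case (const c)
  show ?case by (simp add: poly_op_const giambelli_scal)
next
  case (indet i)
  then show ?case
    using giambelli_D_free[OF assms(1,2) indet(2), of i] by (simp add: poly_op_indet D_poly.simps)
next
  case (add p q)
  then show ?case
    using pres_ideal_add[OF add.IH(1)[of x] add.IH(2)[of x]]
    by (simp add: poly_op_plus giambelli_add algebra_simps)
next
  case (mult p q)
  have "p * (giambelli k (poly_op k q x) - q * giambelli k x) \<in> pres_ideal k n"
    using mult by (intro pres_ideal_mult) auto
  moreover have "giambelli k (poly_op k p (poly_op k q x)) - p * giambelli k (poly_op k q x) \<in> pres_ideal k n"
    using mult by (intro mult.IH poly_op_homogeneous)
  ultimately show ?case
    using pres_ideal_trans by (fastforce simp: poly_op_mult right_diff_distrib mult.assoc)
qed

section \<open>The polynomials that act as zero\<close>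

lemma pres_gens_kill_m0:
  assumes "0 < k" "k \<le> n" "r \<in> pres_gens k n"
  shows "poly_op k r (m0 k) \<in> ext_ideal (act n)"
proof -
  obtain l where k: "k = Suc l" using assms(1) by (cases k) auto
  have P: "D_free h (m0 k) - m0 l * gen (eps (l + h)) \<in> ext_ideal (act n)" for h
    using pieri k by simp
  have q: "gen (eps (i + n)) - scal [:0, 1:] * gen (eps i) \<in> ext_ideal (act n)" for i
    using ext_ideal_gen_scale[of "act n" "[:0, 1:]" "eps i"] by (simp add: act_q)
  have mq: "m0 l * gen (eps (i + n)) - scal [:0, 1:] * (m0 l * gen (eps i)) \<in> ext_ideal (act n)" for i
    using ext_ideal_mult_left[OF q[of i], of "m0 l"]
    by (simp add: right_diff_distrib scal_central[of "m0 l"] flip: mult.assoc)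
  from assms(3) consider h where "h \<in> {n - k + 1..n - 1}" "r = D_poly k h"
    | "r = D_poly k n - const [:0, 1:]" by blast
  then show ?thesis
  proof cases
    case 1
    \<comment> \<open>The new last letter is \<open>\<epsilon>\<^sup>k\<^sup>+\<^sup>h = q \<epsilon>\<^sup>k\<^sup>+\<^sup>h\<^sup>-\<^sup>n\<close>, where \<open>\<epsilon>\<^sup>k\<^sup>+\<^sup>h\<^sup>-\<^sup>n = eps i\<close> is an earlier letter.\<close>
    define i where "i = l + h - n"
    have i: "l + h = i + n" "i < l" using 1(1) assms(2) k by (auto simp: i_def)
    have "scal [:0, 1:] * (m0 l * gen (eps i)) \<in> ext_ideal (act n)"
      using i by (intro ext_ideal_mult_left m0_repeat)
    with mq[of i] have "m0 l * gen (eps (l + h)) \<in> ext_ideal (act n)"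
      unfolding i(1) by (rule ext_ideal_transfer)
    with P[of h] have "D_free h (m0 k) \<in> ext_ideal (act n)"
      by (rule ext_ideal_transfer)
    then show ?thesis by (simp add: 1 poly_op_D_poly homogeneous_m0)
  next
    case 2
    have "(D_free n (m0 k) - m0 l * gen (eps (l + n)))
        + (m0 l * gen (eps (l + n)) - scal [:0, 1:] * (m0 l * gen (eps l))) \<in> ext_ideal (act n)"
      by (intro ext_ideal_add P mq)
    then show ?thesis
      by (simp add: 2 poly_op_diff poly_op_D_poly homogeneous_m0 poly_op_const k flip: m0_Suc)
  qed
qed

text \<open>
  The polynomials that map \<open>cyclic_span n k\<close> to zero modulo the exterior relations form an
  ideal. Since polynomial operators commute with the \<open>D\<^sub>j\<close>, it suffices to test its generators
  on \<open>m\<^sub>0\<close>.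
\<close>

lemma poly_op_pres_ideal:
  assumes "0 < k" "k \<le> n" "p \<in> pres_ideal k n" "x \<in> homogeneous k"
  shows "poly_op k p x \<in> ext_ideal (act n)"
proof -
  define K where "K = {p \<in> polys k. \<forall>x\<in>cyclic_span n k. poly_op k p x \<in> ext_ideal (act n)}"
  let ?P = "poly_ring k"
  have inv: "inv\<^bsub>add_monoid ?P\<^esub> p = - p" if "p \<in> polys k" for p
    using abelian_group.minus_equality[OF ring.is_abelian_group[OF ring_poly_ring], where x = p and y = "- p"]
      that polys_minus[OF that]
    by (simp add: a_inv_def)
  have "ideal K ?P"
  proof (rule idealI[OF ring_poly_ring])
    show "subgroup K (add_monoid ?P)"
    proof
      show "inv\<^bsub>add_monoid ?P\<^esub> p \<in> K" if "p \<in> K" for p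
      proof -
        have "- p \<in> K"
          using that by (simp add: K_def polys_minus poly_op_minus ext_ideal_minus)
        moreover have "p \<in> polys k" using that by (simp add: K_def)
        ultimately show ?thesis by (simp only: inv)
      qed
    qed (auto simp: K_def polys_add poly_op_plus ext_ideal_add additive.zero[OF additive_poly_op])
    show mult: "y \<otimes>\<^bsub>?P\<^esub> r \<in> K" if "r \<in> K" "y \<in> carrier ?P" for r y
      using that by (auto simp: K_def polys_mult poly_op_mult poly_op_ext_ideal)
    show "r \<otimes>\<^bsub>?P\<^esub> y \<in> K" if "r \<in> K" "y \<in> carrier ?P" for r y
      using mult[OF that] by (simp add: mult.commute)
  qed
  moreover have "pres_gens k n \<subseteq> K"
  proof
    fix r assume r: "r \<in> pres_gens k n"
    have "poly_op k r x \<in> ext_ideal (act n)" if "x \<in> cyclic_span n k" for x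
      using that
    proof induction
      case base
      show ?case by (rule pres_gens_kill_m0[OF assms(1,2) r])
    qed (auto simp: poly_op_ext_ideal poly_op_add poly_op_scal poly_op_D_free ext_ideal_add ext_ideal_mult_left D_free_ext_ideal)
    with r pres_gens_polys show "r \<in> K" by (auto simp: K_def)
  qed
  ultimately have "pres_ideal k n \<subseteq> K"
    unfolding pres_ideal_def by (intro ring.genideal_minimal[OF ring_poly_ring])
  moreover have "x \<in> cyclic_span n k" using assms(4) homogeneous_subset_cyclic_span by blast
  ultimately show ?thesis using assms(3) by (auto simp: K_def)
qed

text \<open>
  A polynomial \<open>p\<close> that acts as zero lies in the ideal of the presentation because Giambelli's
  map recovers \<open>p\<close> from \<open>p(D) m\<^sub>0\<close> modulo that ideal.
\<close>

lemma poly_op_kernel: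
  assumes "0 < k" "k \<le> n" "p \<in> polys k"
  shows "(\<forall>x\<in>homogeneous k. poly_op k p x \<in> ext_ideal (act n)) \<longleftrightarrow> p \<in> pres_ideal k n"
proof
  assume "\<forall>x\<in>homogeneous k. poly_op k p x \<in> ext_ideal (act n)"
  then have "giambelli k (poly_op k p (m0 k)) \<in> pres_ideal k n"
    by (intro giambelli_ext_ideal assms) (simp add: homogeneous_m0)
  then show "p \<in> pres_ideal k n"
    using pres_ideal_diff[OF _ giambelli_poly_op[OF assms(1,2) homogeneous_m0 assms(3)]] giambelli_m0[OF assms(1)]
    by fastforce
qed (use poly_op_pres_ideal[OF assms(1,2)] in blast)

section \<open>Operators on the exterior power\<close>

lemma ext_class_altdef: "ext_class s p = {q. q - p \<in> ext_ideal s}"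
proof -
  have "ext_class s p = (\<lambda>i. i + p) ` ext_ideal s"
    by (auto simp: ext_class_def a_r_coset_def r_coset_def ring_of_type_algebra_def)
  also have "\<dots> = {q. q - p \<in> ext_ideal s}"
    by (force intro: image_eqI[of _ _ "_ - p"])
  finally show ?thesis .
qed

lemma ext_class_eq_iff:
  "ext_class s p = ext_class s q \<longleftrightarrow> p - q \<in> ext_ideal s"
proof
  assume "ext_class s p = ext_class s q"
  moreover have "p \<in> ext_class s p" by (simp add: ext_class_altdef)
  ultimately show "p - q \<in> ext_ideal s" by (simp add: ext_class_altdef)
next
  assume pq: "p - q \<in> ext_ideal s"
  have "r - p \<in> ext_ideal s \<longleftrightarrow> r - q \<in> ext_ideal s" for r
    using ext_ideal_add[OF _ pq, of "r - p"] ext_ideal_diff[OF _ pq, of "r - q"] by auto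
  then show "ext_class s p = ext_class s q" by (simp add: ext_class_altdef)
qed

lemma ext_class_add:
  "ring.add (exterior_algebra s) (ext_class s p) (ext_class s q) = ext_class s (p + q)"
  using ideal.a_rcos_sum[OF ideal_ext_ideal[of s], of p q]
  by (simp add: exterior_algebra_def FactRing_def ext_class_def ring_of_type_algebra_def)

lemma ext_class_mult:
  "monoid.mult (exterior_algebra s) (ext_class s p) (ext_class s q) = ext_class s (p * q)"
  using ideal.rcoset_mult_add[OF ideal_ext_ideal[of s], of p q]
  by (simp add: exterior_algebra_def FactRing_def ext_class_def ring_of_type_algebra_def)

lemma ext_class_zero: "ring.zero (exterior_algebra s) = ext_class s 0"
  by (simp add: exterior_algebra_def FactRing_def ext_class_altdef)

lemma exterior_power_sel:
  "carrier (exterior_power k s) = ext_class s ` homogeneous k"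
  "ext_class s p \<oplus>\<^bsub>exterior_power k s\<^esub> ext_class s q = ext_class s (p + q)"
  "c \<odot>\<^bsub>exterior_power k s\<^esub> ext_class s p = ext_class s (scal c * p)"
  "\<zero>\<^bsub>exterior_power k s\<^esub> = ext_class s 0"
  by (simp_all add: exterior_power_def homogeneous_def ext_class_add ext_class_mult ext_class_zero)

text \<open>
  Operators on classes are defined as unions over representatives; this computes them for
  operators that respect the exterior relations.
\<close>

lemma union_ext_class:
  assumes "\<And>q. q - p \<in> ext_ideal s \<Longrightarrow> f q - f p \<in> ext_ideal s"
  shows "(\<Union>q\<in>ext_class s p. ext_class s (f q)) = ext_class s (f p)"
proof -
  have "ext_class s (f q) = ext_class s (f p)" if "q \<in> ext_class s p" for q
    unfolding ext_class_eq_iff using that by (intro assms) (simp add: ext_class_altdef)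
  moreover have "p \<in> ext_class s p" by (simp add: ext_class_altdef)
  ultimately show ?thesis by blast
qed

lemma D_op_class: "D_op n j (ext_class (act n) p) = ext_class (act n) (D_free j p)"
  unfolding hs_ext_def hs_free_nth
  by (rule union_ext_class) (use D_free_ext_ideal hom_coeff_diff in metis)

definition wedge_op :: "nat \<Rightarrow> nat \<Rightarrow> mpoly_q \<Rightarrow>
    (nat \<Rightarrow>\<^sub>0 int, int poly) free_alg set \<Rightarrow> (nat \<Rightarrow>\<^sub>0 int, int poly) free_alg set"
  where "wedge_op k n p = (\<lambda>a\<in>carrier (wedge_M k n). \<Union>x\<in>a. ext_class (act n) (poly_op k p x))"

lemma additive_poly_op_arg: "Modules.additive (poly_op k p)"
  by (simp add: additive_def poly_op_add)

lemma wedge_op_class: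
  assumes "x \<in> homogeneous k"
  shows "wedge_op k n p (ext_class (act n) x) = ext_class (act n) (poly_op k p x)"
proof -
  have "(\<Union>y\<in>ext_class (act n) x. ext_class (act n) (poly_op k p y)) = ext_class (act n) (poly_op k p x)"
    by (rule union_ext_class) (use poly_op_ext_ideal additive.diff[OF additive_poly_op_arg] in metis)
  with assms show ?thesis by (simp add: wedge_op_def exterior_power_sel)
qed

lemma wedge_ext:
  assumes "f \<in> extensional (carrier (wedge_M k n))" "g \<in> extensional (carrier (wedge_M k n))"
    and "\<And>x. x \<in> homogeneous k \<Longrightarrow> f (ext_class (act n) x) = g (ext_class (act n) x)"
  shows "f = g"
  using assms(1,2) by (rule extensionalityI) (use assms(3) in \<open>auto simp: exterior_power_sel\<close>)

lemma class_carrier: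
  "x \<in> homogeneous k \<Longrightarrow> ext_class (act n) x \<in> carrier (wedge_M k n)"
  by (simp add: exterior_power_sel)

lemma wedge_op_extensional: "wedge_op k n p \<in> extensional (carrier (wedge_M k n))"
  by (simp add: wedge_op_def)

abbreviation End_wedge :: "nat \<Rightarrow> nat \<Rightarrow> _"
  where "End_wedge k n \<equiv> module_End Zq (wedge_M k n)"

lemma End_wedge_sel:
  "monoid.mult (End_wedge k n) = compose (carrier (wedge_M k n))"
  "\<one>\<^bsub>End_wedge k n\<^esub> = restrict id (carrier (wedge_M k n))"
  "\<zero>\<^bsub>End_wedge k n\<^esub> = (\<lambda>x\<in>carrier (wedge_M k n). \<zero>\<^bsub>wedge_M k n\<^esub>)"
  "f \<oplus>\<^bsub>End_wedge k n\<^esub> g = (\<lambda>x\<in>carrier (wedge_M k n). f x \<oplus>\<^bsub>wedge_M k n\<^esub> g x)"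
  by (simp_all add: module_End_def)

lemma wedge_op_carrier: "wedge_op k n p \<in> carrier (End_wedge k n)"
proof -
  have "wedge_op k n p \<in> carrier (wedge_M k n) \<rightarrow>\<^sub>E carrier (wedge_M k n)"
    using wedge_op_extensional[of k n p]
    by (auto simp: PiE_def exterior_power_sel wedge_op_class poly_op_homogeneous)
  then show ?thesis
    by (auto simp: module_End_def exterior_power_sel wedge_op_class homogeneous_add homogeneous_scal_mult
        poly_op_add poly_op_scal)
qed

lemma wedge_op_const: "wedge_op k n (const c) = scalar_End (wedge_M k n) c"
  by (rule wedge_ext[OF wedge_op_extensional])
    (simp_all add: scalar_End_def wedge_op_class poly_op_const class_carrier exterior_power_sel(3))

lemma wedge_op_D_poly: "wedge_op k n (D_poly k i) = restrict (D_op n i) (carrier (wedge_M k n))"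
  by (rule wedge_ext[OF wedge_op_extensional])
    (simp_all add: wedge_op_class poly_op_D_poly class_carrier D_op_class)

lemma wedge_op_indet:
  "i \<in> {1..k} \<Longrightarrow> wedge_op k n (indet i) = restrict (D_op n i) (carrier (wedge_M k n))"
  using wedge_op_D_poly[of k n i] by (simp add: D_poly.simps)

lemma wedge_op_1: "wedge_op k n 1 = \<one>\<^bsub>End_wedge k n\<^esub>"
  by (rule wedge_ext[OF wedge_op_extensional])
    (simp_all add: wedge_op_class poly_op_1 class_carrier End_wedge_sel)

lemma wedge_op_mult:
  "wedge_op k n (p * q) = wedge_op k n p \<otimes>\<^bsub>End_wedge k n\<^esub> wedge_op k n q"
  by (rule wedge_ext[OF wedge_op_extensional])
    (simp_all add: wedge_op_class poly_op_mult class_carrier End_wedge_sel compose_def poly_op_homogeneous)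

lemma wedge_op_add:
  "wedge_op k n (p + q) = wedge_op k n p \<oplus>\<^bsub>End_wedge k n\<^esub> wedge_op k n q"
  by (rule wedge_ext[OF wedge_op_extensional])
    (simp_all add: wedge_op_class poly_op_plus class_carrier End_wedge_sel exterior_power_sel(2))

lemma wedge_op_0: "wedge_op k n 0 = \<zero>\<^bsub>End_wedge k n\<^esub>"
  by (rule wedge_ext[OF wedge_op_extensional])
    (simp_all add: wedge_op_class additive.zero[OF additive_poly_op] class_carrier End_wedge_sel exterior_power_sel(4))

lemma wedge_op_minus: "\<ominus>\<^bsub>End_wedge k n\<^esub> wedge_op k n p = wedge_op k n (- p)"
  unfolding a_inv_def m_inv_def
proof (rule the_equality)
  show "wedge_op k n (- p) \<in> carrier (add_monoid (End_wedge k n)) \<and>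
    wedge_op k n p \<otimes>\<^bsub>add_monoid (End_wedge k n)\<^esub> wedge_op k n (- p) = \<one>\<^bsub>add_monoid (End_wedge k n)\<^esub> \<and>
    wedge_op k n (- p) \<otimes>\<^bsub>add_monoid (End_wedge k n)\<^esub> wedge_op k n p = \<one>\<^bsub>add_monoid (End_wedge k n)\<^esub>"
    by (simp add: wedge_op_carrier flip: wedge_op_add wedge_op_0)
next
  fix g
  assume "g \<in> carrier (add_monoid (End_wedge k n)) \<and>
    wedge_op k n p \<otimes>\<^bsub>add_monoid (End_wedge k n)\<^esub> g = \<one>\<^bsub>add_monoid (End_wedge k n)\<^esub> \<and>
    g \<otimes>\<^bsub>add_monoid (End_wedge k n)\<^esub> wedge_op k n p = \<one>\<^bsub>add_monoid (End_wedge k n)\<^esub>"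
  then have g: "g \<in> carrier (End_wedge k n)" "wedge_op k n p \<oplus>\<^bsub>End_wedge k n\<^esub> g = \<zero>\<^bsub>End_wedge k n\<^esub>" by simp_all
  from g(1) have gE: "g \<in> carrier (wedge_M k n) \<rightarrow>\<^sub>E carrier (wedge_M k n)"
    by (simp add: module_End_def)
  show "g = wedge_op k n (- p)"
  proof (rule wedge_ext[OF _ wedge_op_extensional])
    show "g \<in> extensional (carrier (wedge_M k n))" using gE by (simp add: PiE_def)
    fix x :: "(nat \<Rightarrow>\<^sub>0 int, int poly) free_alg" assume x: "x \<in> homogeneous k"
    then have "g (ext_class (act n) x) \<in> carrier (wedge_M k n)"
      using gE class_carrier by blast
    then obtain y where y: "g (ext_class (act n) x) = ext_class (act n) y"
      by (auto simp: exterior_power_sel)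
    have "(wedge_op k n p \<oplus>\<^bsub>End_wedge k n\<^esub> g) (ext_class (act n) x) = \<zero>\<^bsub>End_wedge k n\<^esub> (ext_class (act n) x)"
      using g(2) by simp
    then have "ext_class (act n) (poly_op k p x + y) = ext_class (act n) 0"
      using x by (simp add: End_wedge_sel class_carrier wedge_op_class y exterior_power_sel(2,4))
    then show "g (ext_class (act n) x) = wedge_op k n (- p) (ext_class (act n) x)"
      using x by (simp add: y wedge_op_class poly_op_minus ext_class_eq_iff add.commute)
  qed
qed

text \<open>
  The generators \<open>D\<^sub>i\<close> with \<open>i > k\<close> are no problem, because they are the actions of the
  polynomials \<open>D\<^sub>i\<close> in \<open>D\<^sub>1, \<dots>, D\<^sub>k\<close>.
\<close>

lemma carrier_intersection_ring:
  "carrier (intersection_ring Zq (wedge_M k n) (D_op n)) = wedge_op k n ` polys k"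
proof -
  let ?G = "scalar_End (wedge_M k n) ` carrier Zq \<union>
    {restrict (D_op n i) (carrier (wedge_M k n)) |i. i \<ge> 1}"
  have "f \<in> wedge_op k n ` polys k" if "f \<in> generate_ring (End_wedge k n) ?G" for f
    using that
  proof induction
    case one
    show ?case unfolding wedge_op_1[symmetric] by (intro imageI polys_1)
  next
    case (incl f)
    then show ?case
      by (auto simp flip: wedge_op_const wedge_op_D_poly intro!: imageI D_poly_polys)
  next
    case (a_inv f)
    then show ?case by (auto simp: wedge_op_minus intro!: imageI polys_minus)
  next
    case (eng_add f g)
    then show ?case by (auto simp flip: wedge_op_add intro!: imageI polys_add)
  next
    case (eng_mult f g)
    then show ?case by (auto simp flip: wedge_op_mult intro!: imageI polys_mult)
  qed
  moreover have "wedge_op k n p \<in> generate_ring (End_wedge k n) ?G" if "p \<in> polys k" for p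
    using that
  proof (induction rule: polys_induct)
    case (const c)
    show ?case unfolding wedge_op_const
      by (rule generate_ring.incl) (simp add: ring_of_type_algebra_def)
  next
    case (indet i)
    then show ?case unfolding wedge_op_indet[OF indet]
      by (intro generate_ring.incl) auto
  qed (simp_all add: wedge_op_add wedge_op_mult generate_ring.eng_add generate_ring.eng_mult)
  ultimately show ?thesis
    by (auto simp: intersection_ring_def)
qed

lemma wedge_op_eq_iff:
  assumes "0 < k" "k \<le> n" "p \<in> polys k" "q \<in> polys k"
  shows "wedge_op k n p = wedge_op k n q \<longleftrightarrow> p - q \<in> pres_ideal k n"
proof -
  have "wedge_op k n p = wedge_op k n q \<longleftrightarrow> (\<forall>x\<in>homogeneous k. wedge_op k n p (ext_class (act n) x) = wedge_op k n q (ext_class (act n) x))"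
    using wedge_ext[OF wedge_op_extensional wedge_op_extensional] by metis
  also have "\<dots> \<longleftrightarrow> (\<forall>x\<in>homogeneous k. poly_op k (p - q) x \<in> ext_ideal (act n))"
    by (simp add: wedge_op_class ext_class_eq_iff poly_op_diff)
  also have "\<dots> \<longleftrightarrow> p - q \<in> pres_ideal k n"
    using assms by (intro poly_op_kernel) (simp_all add: polys_diff)
  finally show ?thesis .
qed

section \<open>The isomorphism\<close>

lemma pres_class_altdef:
  assumes "p \<in> polys k"
  shows "pres_class k n p = {q \<in> polys k. q - p \<in> pres_ideal k n}"
proof -
  have "pres_class k n p = (\<lambda>i. i + p) ` pres_ideal k n"
    by (auto simp: pres_class_def a_r_coset_def r_coset_def)
  also have "\<dots> = {q \<in> polys k. q - p \<in> pres_ideal k n}"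
  proof (intro subset_antisym subsetI)
    fix q assume "q \<in> (\<lambda>i. i + p) ` pres_ideal k n"
    then obtain i where "i \<in> pres_ideal k n" "q = i + p" by blast
    with pres_ideal_subset[of i k n] assms show "q \<in> {q \<in> polys k. q - p \<in> pres_ideal k n}"
      by (simp add: polys_add)
  next
    fix q assume "q \<in> {q \<in> polys k. q - p \<in> pres_ideal k n}"
    then show "q \<in> (\<lambda>i. i + p) ` pres_ideal k n"
      by (intro image_eqI[of _ _ "q - p"]) simp_all
  qed
  finally show ?thesis .
qed

lemma pres_ring_sel:
  "carrier (pres_ring k n) = pres_class k n ` polys k"
  "\<one>\<^bsub>pres_ring k n\<^esub> = pres_class k n 1"
  by (auto simp: pres_ring_def FactRing_def A_RCOSETS_def' pres_class_def)

lemma pres_class_mult: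
  assumes "p \<in> polys k" "q \<in> polys k"
  shows "pres_class k n p \<otimes>\<^bsub>pres_ring k n\<^esub> pres_class k n q = pres_class k n (p * q)"
  using ideal.rcoset_mult_add[OF ideal_pres_ideal, of p k q n] assms
  by (simp add: pres_ring_def FactRing_def pres_class_def)

lemma pres_class_add:
  assumes "p \<in> polys k" "q \<in> polys k"
  shows "pres_class k n p \<oplus>\<^bsub>pres_ring k n\<^esub> pres_class k n q = pres_class k n (p + q)"
  using ideal.a_rcos_sum[OF ideal_pres_ideal, of p k q n] assms
  by (simp add: pres_ring_def FactRing_def pres_class_def)

lemma intersection_ring_sel:
  "monoid.mult (intersection_ring Zq (wedge_M k n) (D_op n)) = monoid.mult (End_wedge k n)"
  "ring.add (intersection_ring Zq (wedge_M k n) (D_op n)) = ring.add (End_wedge k n)"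
  "monoid.one (intersection_ring Zq (wedge_M k n) (D_op n)) = monoid.one (End_wedge k n)"
  by (simp_all add: intersection_ring_def)

theorem proposition4p4:
  fixes k n :: nat
  assumes "1 \<le> k" and "k \<le> n"
  shows "\<exists>\<phi> \<in> ring_iso (intersection_ring Zq (wedge_M k n) (D_op n)) (pres_ring k n).
    (\<forall>c. \<phi> (scalar_End (wedge_M k n) c) = pres_class k n (const c)) \<and>
    (\<forall>i\<in>{1..k}. \<phi> (restrict (D_op n i) (carrier (wedge_M k n))) = pres_class k n (indet i))"
proof -
  \<comment> \<open>The set of all polynomials that act as \<open>f\<close> is a coset of the ideal of the presentation, because
  this ideal consists of the polynomials that act as zero.\<close>
  define \<phi> where "\<phi> f = {p \<in> polys k. wedge_op k n p = f}" for f
  have eq: "wedge_op k n p = wedge_op k n q \<longleftrightarrow> p - q \<in> pres_ideal k n" if "p \<in> polys k" "q \<in> polys k" for p q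
    using assms that by (intro wedge_op_eq_iff) simp_all
  have \<phi>: "\<phi> (wedge_op k n p) = pres_class k n p" if "p \<in> polys k" for p
    unfolding \<phi>_def pres_class_altdef[OF that] using eq[OF _ that] by blast
  have inj: "wedge_op k n p = wedge_op k n q" if "pres_class k n p = pres_class k n q" "p \<in> polys k" "q \<in> polys k" for p q
  proof -
    have "p \<in> pres_class k n q"
      unfolding that(1)[symmetric] by (simp add: pres_class_altdef that(2))
    then show ?thesis by (simp add: pres_class_altdef that(3) eq[OF that(2,3)])
  qed
  have "\<phi> \<in> ring_iso (intersection_ring Zq (wedge_M k n) (D_op n)) (pres_ring k n)"
  proof (rule ring_iso_memI)
    show "bij_betw \<phi> (carrier (intersection_ring Zq (wedge_M k n) (D_op n))) (carrier (pres_ring k n))"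
      unfolding carrier_intersection_ring pres_ring_sel bij_betw_def
      by (auto simp: inj_on_def \<phi> image_image intro: inj)
    show "\<phi> \<one>\<^bsub>intersection_ring Zq (wedge_M k n) (D_op n)\<^esub> = \<one>\<^bsub>pres_ring k n\<^esub>"
      unfolding intersection_ring_sel pres_ring_sel wedge_op_1[symmetric] by (rule \<phi>) simp
  next
    fix f assume "f \<in> carrier (intersection_ring Zq (wedge_M k n) (D_op n))"
    then show "\<phi> f \<in> carrier (pres_ring k n)"
      unfolding carrier_intersection_ring pres_ring_sel by (auto simp: \<phi>)
  next
    fix f g
    assume "f \<in> carrier (intersection_ring Zq (wedge_M k n) (D_op n))"
      and "g \<in> carrier (intersection_ring Zq (wedge_M k n) (D_op n))"
    then obtain p q where p: "p \<in> polys k" "f = wedge_op k n p" and q: "q \<in> polys k" "g = wedge_op k n q"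
      unfolding carrier_intersection_ring by blast
    show "\<phi> (f \<otimes>\<^bsub>intersection_ring Zq (wedge_M k n) (D_op n)\<^esub> g) = \<phi> f \<otimes>\<^bsub>pres_ring k n\<^esub> \<phi> g"
      unfolding intersection_ring_sel p q wedge_op_mult[symmetric]
      using p(1) q(1) by (simp add: \<phi> polys_mult pres_class_mult)
    show "\<phi> (f \<oplus>\<^bsub>intersection_ring Zq (wedge_M k n) (D_op n)\<^esub> g) = \<phi> f \<oplus>\<^bsub>pres_ring k n\<^esub> \<phi> g"
      unfolding intersection_ring_sel p q wedge_op_add[symmetric]
      using p(1) q(1) by (simp add: \<phi> polys_add pres_class_add)
  qed
  moreover have "\<phi> (scalar_End (wedge_M k n) c) = pres_class k n (const c)" for c
    using \<phi>[OF polys_const] by (simp only: wedge_op_const)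
  moreover have "\<phi> (restrict (D_op n i) (carrier (wedge_M k n))) = pres_class k n (indet i)"
    if "i \<in> {1..k}" for i
    using \<phi>[OF polys_indet[OF that]] by (simp only: wedge_op_indet[OF that])
  ultimately show ?thesis by blast
qed

end
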